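(* Let $\Phi:\mathbb{R}^n\to\mathbb{R}\cup\{+\infty\}$ be a proper, convex, lower semicontinuous function satisfying the structural setting (S) described in the context, with orthogonal decomposition $\mathbb{R}^n=X_1\oplus X_2\oplus X_3$, and let $L\in\mathbb{R}^{m\times n}$ be such that $X_2\cap\mathcal{N}(L)=\{0\}$, $X_3\cap\mathcal{R}(L^* )=\{0\}$ and $\operatorname{argmin}\Phi\cap\mathcal{N}(L)=\emptyset$. Let $\|\cdot\|$ be an arbitrary norm on $\mathbb{R}^m$ with dual norm $\|\cdot\|_*$, and define $$c:=\inf_{x\in\operatorname{argmin}\Phi}\|Lx\|,\qquad d:=\inf_{p\in\operatorname{argmin}\Phi^*(-L^*\cdot)}\|p\|_*\in[0,+\infty].$$ Then, for all $\tau\in(0,c)$ and $\lambda\in(0,d)$, the problems $(P_{1,\tau})$, $(P_{2,\lambda})$, $(D_{1,\tau})$, $(D_{2,\lambda})$ have solutions with finite minima. Further, there exists a bijective mapping $g:(0,c)\to(0,d)$ such that: 1. for $\tau\in(0,c)$ and $\lambda\in(0,d)$ with $(\tau,\lambda)\in\operatorname{gr} g$ we have $\mathrm{SOL}(P_{1,\tau})=\mathrm{SOL}(P_{2,\lambda})$ and $\mathrm{SOL}(D_{1,\tau})=\mathrm{SOL}(D_{2,\lambda})$; 2. whenever ($\tau\in(0,c)$ and $\lambda\in[0,+\infty)$) or ($\lambda\in(0,d)$ and $\tau\in[0,+\infty)$), and $(\tau,\lambda)\notin\operatorname{gr} g$, we have $\mathrm{SOL}(P_{1,\tau})\cap\mathrm{SOL}(P_{2,\lambda})=\emptyset$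 and $\mathrm{SOL}(D_{1,\tau})\cap\mathrm{SOL}(D_{2,\lambda})=\emptyset$; 3. for $(\tau,\lambda)\in\operatorname{gr} g$, any solutions $\hat x$ and $\hat p$ of the primal and dual problems, respectively, fulfill $\tau=\|L\hat x\|$ and $\lambda=\|\hat p\|_*$.
   Context: Setting (S): $\mathbb{R}^n=X_1\oplus X_2\oplus X_3$ is a decomposition into pairwise orthogonal subspaces (each $x$ is written uniquely as $x=x_1+x_2+x_3$, $x_i\in X_i$) such that $\Phi(x)=\phi(x_1)$ if $x_3=0$ and $\Phi(x)=+\infty$ if $x_3\neq0$, where $\phi=\Phi|_{X_1}:X_1\to\mathbb{R}\cup\{+\infty\}$ fulfills: (i) $\operatorname{dom}\phi$ is an open subset of $X_1$ with $0\in\overline{\operatorname{dom}\phi}$; (ii) $\phi$ is proper, convex, lower semicontinuous, strictly convex and essentially smooth; (iii) $\phi$ has a minimizer. Here $\operatorname{dom}\phi=\{x:\phi(x)<+\infty\}$; a convex function $\phi$ on $X_1$ is essentially smooth if the interior $C$ of $\operatorname{dom}\phi$ in $X_1$ is nonempty, $\phi$ is differentiable on $C$, and $\|\nabla\phi(x^{(k)})\|\to+\infty$ for every sequence in $C$ converging to a boundary point of $C$. $\Phi^*(p)=\sup_x\{\langle p,x\rangle-\Phi(x)\}$ is the Fenchel conjugate, $L^*$ the transpose of $L$, $\mathcal{N}$ and $\mathcal{R}$ denote nullspace and range, $\|p\|_*=\max_{\|x\|\le1}\langle p,x\rangle$, $\operatorname{gr} g$ is the graph of $g$, $\inf\emptyset=+\infty$.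 Problems, for $\tau,\lambda\in[0,+\infty)$ (with convention $0\cdot(+\infty)=0$): $(P_{1,\tau})$: minimize $\Phi(x)$ over $x\in\mathbb{R}^n$ subject to $\|Lx\|\le\tau$; $(P_{2,\lambda})$: minimize $\Phi(x)+\lambda\|Lx\|$ over $x\in\mathbb{R}^n$; $(D_{1,\tau})$: minimize $\Phi^*(-L^*p)+\tau\|p\|_*$ over $p\in\mathbb{R}^m$; $(D_{2,\lambda})$: minimize $\Phi^*(-L^*p)$ over $p\in\mathbb{R}^m$ subject to $\|p\|_*\le\lambda$. $\mathrm{SOL}(\cdot)$ denotes the set of solutions (minimizers): for a problem "minimize $F$ over the feasible set $S$" it is $\{\hat x\in S: F(\hat x)\le F(x)\ \forall x\in S\}$. *)

theory Defs
  imports "HOL-Analysis.Analysis"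
begin

section \<open>Extended-real-valued convex functions relative to a subspace\<close>

text \<open>
  Functions into \<open>\<real> \<union> {+\<infinity>}\<close> are functions into \<^typ>\<open>ereal\<close> that avoid \<open>-\<infinity>\<close> (part of
  \<open>proper_on\<close>).  The restriction of \<open>f\<close> to a subspace \<open>X\<close> is not a separate function: every
  notion below takes \<open>X\<close> as an argument and looks at \<open>f\<close> on \<open>X\<close> only, and all topological
  notions are relative to \<open>X\<close>.
\<close>

definition edom_on :: "'a set \<Rightarrow> ('a \<Rightarrow> ereal) \<Rightarrow> 'a set" where
  "edom_on X f = {x \<in> X. f x < \<infinity>}"

definition proper_on :: "'a set \<Rightarrow> ('a \<Rightarrow> ereal) \<Rightarrow> bool" where
  "proper_on X f \<longleftrightarrow> (\<forall>x\<in>X. f x \<noteq> -\<infinity>) \<and> edom_on X f \<noteq> {}"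

definition econvex_on :: "'a::real_vector set \<Rightarrow> ('a \<Rightarrow> ereal) \<Rightarrow> bool" where
  "econvex_on X f \<longleftrightarrow> convex X \<and>
     (\<forall>x\<in>X. \<forall>y\<in>X. \<forall>u\<in>{0<..<1::real}.
        f ((1 - u) *\<^sub>R x + u *\<^sub>R y) \<le> ereal (1 - u) * f x + ereal u * f y)"

definition strictly_econvex_on :: "'a::real_vector set \<Rightarrow> ('a \<Rightarrow> ereal) \<Rightarrow> bool" where
  "strictly_econvex_on X f \<longleftrightarrow> econvex_on X f \<and>
     (\<forall>x\<in>edom_on X f. \<forall>y\<in>edom_on X f. \<forall>u\<in>{0<..<1::real}. x \<noteq> y \<longrightarrow>
        f ((1 - u) *\<^sub>R x + u *\<^sub>R y) < ereal (1 - u) * f x + ereal u * f y)"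

definition lsc_on :: "'a::topological_space set \<Rightarrow> ('a \<Rightarrow> ereal) \<Rightarrow> bool" where
  "lsc_on X f \<longleftrightarrow> (\<forall>x\<in>X. f x \<le> Liminf (at x within X) f)"

text \<open>
  The gradient of the restriction of \<open>f\<close> to the subspace \<open>X\<close> is a vector of \<open>X\<close>; this is what
  makes it unique.  At points in the relative interior of the effective domain,
  \<^const>\<open>real_of_ereal\<close> does not hide infinite values.
\<close>

definition has_gradient_on ::
  "'a::euclidean_space set \<Rightarrow> ('a \<Rightarrow> ereal) \<Rightarrow> 'a \<Rightarrow> 'a \<Rightarrow> bool" where
  "has_gradient_on X f x g \<longleftrightarrow>
     g \<in> X \<and> ((\<lambda>y. real_of_ereal (f y)) has_derivative (\<lambda>h. g \<bullet> h)) (at x within X)"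

definition gradient_on :: "'a::euclidean_space set \<Rightarrow> ('a \<Rightarrow> ereal) \<Rightarrow> 'a \<Rightarrow> 'a" where
  "gradient_on X f x = (THE g. has_gradient_on X f x g)"

definition essentially_smooth_on ::
  "'a::euclidean_space set \<Rightarrow> ('a \<Rightarrow> ereal) \<Rightarrow> bool" where
  "essentially_smooth_on X f \<longleftrightarrow>
     (let C = top_of_set X interior_of edom_on X f in
        C \<noteq> {} \<and>
        (\<forall>x\<in>C. \<exists>g. has_gradient_on X f x g) \<and>
        (\<forall>s l. (\<forall>k. s k \<in> C) \<and> s \<longlonglongrightarrow> l \<and> l \<in> top_of_set X frontier_of C \<longrightarrow>
           filterlim (\<lambda>k. norm (gradient_on X f (s k))) at_top sequentially))"

definition conjugate :: "('a::euclidean_space \<Rightarrow> ereal) \<Rightarrow> 'a \<Rightarrow> ereal" where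
  "conjugate f p = (SUP x. ereal (p \<bullet> x) - f x)"

section \<open>Orthogonal decompositions and the structural setting\<close>

definition orthogonal_decomposition ::
  "'a::euclidean_space set \<Rightarrow> 'a set \<Rightarrow> 'a set \<Rightarrow> bool" where
  "orthogonal_decomposition X1 X2 X3 \<longleftrightarrow>
     subspace X1 \<and> subspace X2 \<and> subspace X3 \<and>
     (\<forall>x\<in>X1. \<forall>y\<in>X2. orthogonal x y) \<and>
     (\<forall>x\<in>X1. \<forall>y\<in>X3. orthogonal x y) \<and>
     (\<forall>x\<in>X2. \<forall>y\<in>X3. orthogonal x y) \<and>
     (\<forall>x. \<exists>!(x1, x2, x3). x1 \<in> X1 \<and> x2 \<in> X2 \<and> x3 \<in> X3 \<and> x = x1 + x2 + x3)"

definition structural_setting ::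
  "('a::euclidean_space \<Rightarrow> ereal) \<Rightarrow> 'a set \<Rightarrow> 'a set \<Rightarrow> 'a set \<Rightarrow> bool" where
  "structural_setting \<Phi> X1 X2 X3 \<longleftrightarrow>
     orthogonal_decomposition X1 X2 X3 \<and>
     (\<forall>x1\<in>X1. \<forall>x2\<in>X2. \<forall>x3\<in>X3.
        \<Phi> (x1 + x2 + x3) = (if x3 = 0 then \<Phi> x1 else \<infinity>)) \<and>
     openin (top_of_set X1) (edom_on X1 \<Phi>) \<and> 0 \<in> closure (edom_on X1 \<Phi>) \<and>
     proper_on X1 \<Phi> \<and> econvex_on X1 \<Phi> \<and> lsc_on X1 \<Phi> \<and>
     strictly_econvex_on X1 \<Phi> \<and> essentially_smooth_on X1 \<Phi> \<and>
     (\<exists>x\<in>X1. \<forall>y\<in>X1. \<Phi> x \<le> \<Phi> y)"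

section \<open>Norms\<close>

definition is_norm :: "('a::real_vector \<Rightarrow> real) \<Rightarrow> bool" where
  "is_norm N \<longleftrightarrow>
     (\<forall>x. 0 \<le> N x) \<and> (\<forall>x. N x = 0 \<longleftrightarrow> x = 0) \<and>
     (\<forall>a x. N (a *\<^sub>R x) = \<bar>a\<bar> * N x) \<and> (\<forall>x y. N (x + y) \<le> N x + N y)"

text \<open>For a norm on a Euclidean space the unit ball is compact, so the supremum is a maximum.\<close>

definition dual_norm :: "('a::euclidean_space \<Rightarrow> real) \<Rightarrow> 'a \<Rightarrow> real" where
  "dual_norm N p = (SUP x\<in>{x. N x \<le> 1}. p \<bullet> x)"

section \<open>Minimization problems\<close>

text \<open>A problem is a pair of an objective function and a feasible set.\<close>

type_synonym 'a problem = "('a \<Rightarrow> ereal) \<times> 'a set"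

definition SOL :: "'a problem \<Rightarrow> 'a set" where
  "SOL P = {x \<in> snd P. \<forall>y\<in>snd P. fst P x \<le> fst P y}"

definition has_finite_minimum :: "'a problem \<Rightarrow> bool" where
  "has_finite_minimum P \<longleftrightarrow> (\<exists>x\<in>SOL P. \<bar>fst P x\<bar> \<noteq> \<infinity>)"

definition argmin :: "('a \<Rightarrow> ereal) \<Rightarrow> 'a set" where
  "argmin f = SOL (f, UNIV)"

definition P1 ::
  "(real^'n \<Rightarrow> ereal) \<Rightarrow> real^'n^'m \<Rightarrow> (real^'m \<Rightarrow> real) \<Rightarrow> real \<Rightarrow> (real^'n) problem" where
  "P1 \<Phi> L N \<tau> = (\<Phi>, {x. N (L *v x) \<le> \<tau>})"

definition P2 ::
  "(real^'n \<Rightarrow> ereal) \<Rightarrow> real^'n^'m \<Rightarrow> (real^'m \<Rightarrow> real) \<Rightarrow> real \<Rightarrow> (real^'n) problem" where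
  "P2 \<Phi> L N \<mu> = (\<lambda>x. \<Phi> x + ereal (\<mu> * N (L *v x)), UNIV)"

definition D1 ::
  "(real^'n \<Rightarrow> ereal) \<Rightarrow> real^'n^'m \<Rightarrow> (real^'m \<Rightarrow> real) \<Rightarrow> real \<Rightarrow> (real^'m) problem" where
  "D1 \<Phi> L N \<tau> =
     (\<lambda>p. conjugate \<Phi> (- (transpose L *v p)) + ereal (\<tau> * dual_norm N p), UNIV)"

definition D2 ::
  "(real^'n \<Rightarrow> ereal) \<Rightarrow> real^'n^'m \<Rightarrow> (real^'m \<Rightarrow> real) \<Rightarrow> real \<Rightarrow> (real^'m) problem" where
  "D2 \<Phi> L N \<mu> = (\<lambda>p. conjugate \<Phi> (- (transpose L *v p)), {p. dual_norm N p \<le> \<mu>})"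

section \<open>Intervals with extended right end point and graphs\<close>

definition open_from_0 :: "ereal \<Rightarrow> real set" where
  "open_from_0 c = {t. 0 < t \<and> ereal t < c}"

definition graph_on :: "'a set \<Rightarrow> ('a \<Rightarrow> 'b) \<Rightarrow> ('a \<times> 'b) set" where
  "graph_on A g = {(t, g t) | t. t \<in> A}"

end

theory Submission
  imports Defs
begin

text \<open>
  Call \<open>(x, p)\<close> a Fenchel pair if \<open>-L\<^sup>T p\<close> is a subgradient of \<open>\<Phi>\<close> at \<open>x\<close>.  Separating the epigraph
  of the image of \<open>\<Phi>\<close> under \<open>L\<close> from a ball or from the hypograph of a multiple of \<open>-N\<close> shows that
  every primal solution has a multiplier, so primal and dual solutions are exactly the Fenchel pairs
  with \<open>p \<bullet> L x = \<tau> \<parallel>p\<parallel>\<^sub>*\<close> (for \<open>\<tau>\<close>) respectively \<open>p \<bullet> L x = \<mu> \<parallel>L x\<parallel>\<close> (for \<open>\<mu>\<close>).  Strict convexity fixes the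
  \<open>X1\<close>-part of a solution, and differentiability then fixes the number \<open>p \<bullet> L x\<close>.  Hence \<open>\<tau>\<close> and
  \<open>\<mu>\<close> determine each other through \<open>p \<bullet> L x = \<tau> \<mu>\<close>, \<open>\<tau> = \<parallel>L x\<parallel>\<close>, \<open>\<mu> = \<parallel>p\<parallel>\<^sub>*\<close>, which defines the
  graph of \<open>g\<close>.
\<close>

section \<open>Separation and norms\<close>

text \<open>\<open>A\<close> is separated from the strict hypograph of \<open>\<theta>\<close> over
  \<open>W\<close>. Since \<open>y0\<close> is interior to \<open>W\<close> and is also the base of
  a point of \<open>A\<close>, the separating hyperplane is not vertical, and its normal can be
  scaled to have last coordinate 1. Two choices of \<open>\<theta>\<close> below give the
  multipliers of the constrained and the penalized problem.\<close>

lemma sandwich_affine: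
  fixes A :: "('b::euclidean_space \<times> real) set" and W :: "'b set"
  assumes A: "convex A" and W: "concave_on W \<theta>"
    and ge: "\<And>y s. (y, s) \<in> A \<Longrightarrow> y \<in> W \<Longrightarrow> \<theta> y \<le> s"
    and y0: "(y0, s0) \<in> A" "y0 \<in> interior W"
  obtains q where "\<And>z s y. (z, s) \<in> A \<Longrightarrow> y \<in> W \<Longrightarrow> q \<bullet> y + \<theta> y \<le> q \<bullet> z + s"
proof -
  define B where "B = {(y, s). y \<in> W \<and> s < \<theta> y}"
  have "convex B"
  proof (rule convexI)
    fix z w :: "'b \<times> real" and u v :: real
    assume zw: "z \<in> B" "w \<in> B" and uv: "0 \<le> u" "0 \<le> v" "u + v = 1"
    obtain y s y' s' where z: "z = (y, s)" "w = (y', s')" by (cases z, cases w)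
    have m: "y \<in> W" "y' \<in> W" "s < \<theta> y" "s' < \<theta> y'" using zw by (auto simp: B_def z)
    have "u *\<^sub>R y + v *\<^sub>R y' \<in> W"
      using W m uv by (auto simp: concave_on_def convex_on_def convex_def)
    moreover have "u * \<theta> y + v * \<theta> y' \<le> \<theta> (u *\<^sub>R y + v *\<^sub>R y')"
      using W m uv by (auto simp: concave_on_iff)
    moreover have "u * s + v * s' < u * \<theta> y + v * \<theta> y'"
    proof (cases "u = 0")
      case False
      then have "u * s < u * \<theta> y" using m uv by simp
      moreover have "v * s' \<le> v * \<theta> y'" using m uv by (simp add: mult_left_mono)
      ultimately show ?thesis by simp
    qed (use uv m in auto)
    ultimately show "u *\<^sub>R z + v *\<^sub>R w \<in> B" by (auto simp: B_def z)
  qed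
  have y0W: "y0 \<in> W" using y0 interior_subset by blast
  have Bmem: "(y, \<theta> y - e) \<in> B" if "y \<in> W" "0 < e" for y e using that by (simp add: B_def)
  have "B \<noteq> {}" using Bmem[OF y0W, of 1] by auto
  moreover have "B \<inter> A = {}" using ge by (fastforce simp: B_def)
  ultimately obtain a b where ab: "a \<noteq> 0" "\<forall>x\<in>B. a \<bullet> x \<le> b" "\<forall>x\<in>A. b \<le> a \<bullet> x"
    using separating_hyperplane_sets[OF \<open>convex B\<close> A] y0 by blast
  obtain q r where a: "a = (q, r)" by fastforce
  have leB: "q \<bullet> y + r * (\<theta> y - e) \<le> b" if "y \<in> W" "0 < e" for y e
    using ab(2) Bmem[OF that] by (auto simp: a)
  have geA: "b \<le> q \<bullet> z + r * s" if "(z, s) \<in> A" for z s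
    using ab(3) that by (auto simp: a)
  have le: "q \<bullet> y + r * (\<theta> y - e) \<le> q \<bullet> z + r * s"
    if "y \<in> W" "0 < e" "(z, s) \<in> A" for y e z s
    using leB[OF that(1,2)] geA[OF that(3)] by linarith
  have "0 \<le> r"
  proof (rule ccontr)
    assume "\<not> 0 \<le> r"
    then have r: "r < 0" by simp
    \<comment> \<open>This drop puts a point of \<open>B\<close> over \<open>y0\<close> strictly
      below \<open>s0\<close>, which a negative \<open>r\<close> does not allow.\<close>
    define e where "e = \<bar>s0 - \<theta> y0\<bar> + 1"
    have "q \<bullet> y0 + r * (\<theta> y0 - e) \<le> q \<bullet> y0 + r * s0"
      using le[OF y0W _ y0(1), of e] by (simp add: e_def)
    then have "r * (\<theta> y0 - e) \<le> r * s0" by simp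
    then have "s0 \<le> \<theta> y0 - e" using r by (simp add: mult_le_cancel_left)
    then show False unfolding e_def by arith
  qed
  \<comment> \<open>A vertical hyperplane would make \<open>y0\<close> a maximizer over
    \<open>W\<close> of the nonzero functional \<open>q\<close>, which is impossible at an interior
    point.\<close>
  moreover have "r \<noteq> 0"
  proof
    assume r: "r = 0"
    then have q: "q \<noteq> 0" using ab(1) a by (auto simp: zero_prod_def)
    obtain e where e: "0 < e" "ball y0 e \<subseteq> W" using y0(2) mem_interior by blast
    define t where "t = e / (2 * norm q)"
    have t: "0 < t" using e q by (simp add: t_def)
    have "y0 + t *\<^sub>R q \<in> ball y0 e" using e q by (simp add: t_def dist_norm)
    then have "q \<bullet> (y0 + t *\<^sub>R q) \<le> q \<bullet> y0"
      using le[of "y0 + t *\<^sub>R q" 1 y0 s0] e y0 r by auto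
    then have "t * (q \<bullet> q) \<le> 0" by (simp add: inner_add_right)
    then have "q \<bullet> q \<le> 0" using t by (simp add: mult_le_0_iff)
    then show False using q inner_gt_zero_iff[of q] by linarith
  qed
  ultimately have r: "0 < r" by simp
  have "(q /\<^sub>R r) \<bullet> y + \<theta> y \<le> (q /\<^sub>R r) \<bullet> z + s" if "(z, s) \<in> A" "y \<in> W" for z s y
  proof (rule field_le_epsilon)
    \<comment> \<open>\<open>B\<close> lies strictly below \<open>\<theta>\<close>, so the
      inequality is available only up to an arbitrary \<open>e > 0\<close>.\<close>
    fix e :: real assume "0 < e"
    have "q \<bullet> y + r * \<theta> y \<le> q \<bullet> z + r * s + r * e"
      using le[OF that(2) \<open>0 < e\<close> that(1)] by (simp add: algebra_simps)
    then have "(q \<bullet> y + r * \<theta> y) / r \<le> (q \<bullet> z + r * s + r * e) / r"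
      using r by (intro divide_right_mono) auto
    moreover have "(q \<bullet> y + r * \<theta> y) / r = (q /\<^sub>R r) \<bullet> y + \<theta> y"
      "(q \<bullet> z + r * s + r * e) / r = (q /\<^sub>R r) \<bullet> z + s + e"
      using r by (simp_all add: field_simps)
    ultimately show "(q /\<^sub>R r) \<bullet> y + \<theta> y \<le> (q /\<^sub>R r) \<bullet> z + s + e"
      by simp
  qed
  then show thesis using that by blast
qed

section \<open>Arbitrary norms and their duals\<close>

context
  fixes N :: "'a::euclidean_space \<Rightarrow> real"
  assumes N: "is_norm N"
begin

lemma is_norm_nonneg: "0 \<le> N x" and is_norm_eq_0: "N x = 0 \<longleftrightarrow> x = 0"
  and is_norm_scale: "N (a *\<^sub>R x) = \<bar>a\<bar> * N x" and is_norm_triangle: "N (x + y) \<le> N x + N y"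
  using N by (auto simp: is_norm_def)

lemma is_norm_zero: "N 0 = 0"
  by (simp add: is_norm_eq_0)

lemma convex_on_is_norm: "convex_on UNIV N"
  by (rule convex_onI) (auto intro!: order_trans[OF is_norm_triangle] simp: is_norm_scale)

lemma continuous_on_is_norm: "continuous_on S N"
  using convex_on_continuous[OF open_UNIV convex_on_is_norm] continuous_on_subset by blast

text \<open>By homogeneity it suffices to look at the compact Euclidean unit sphere, where the
  continuous \<open>N\<close> has a positive minimum.\<close>

lemma is_norm_ge_norm:
  obtains e where "0 < e" "\<And>x. e * norm x \<le> N x"
proof (cases "sphere (0::'a) 1 = {}")
  case True
  then have "x = 0" for x :: 'a
    by (metis empty_iff sphere_eq_empty zero_less_one less_le_not_le linorder_not_le)
  then have "1 * norm x \<le> N x" for x using is_norm_nonneg by (metis norm_zero mult_zero_right)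
  then show ?thesis using that[of 1] by simp
next
  case False
  then obtain z where z: "z \<in> sphere 0 1" "\<And>y. y \<in> sphere 0 1 \<Longrightarrow> N z \<le> N y"
    using continuous_attains_inf[OF compact_sphere _ continuous_on_is_norm] by metis
  have "N z * norm x \<le> N x" for x
  proof (cases "x = 0")
    case False
    then have "N z \<le> N (x /\<^sub>R norm x)" by (intro z) simp
    then show ?thesis using False by (simp add: is_norm_scale field_simps)
  qed (simp add: is_norm_nonneg)
  moreover have "0 < N z" using z(1) is_norm_eq_0[of z] is_norm_nonneg[of z] by fastforce
  ultimately show ?thesis using that by blast
qed

text \<open>The supremum in \<open>dual_norm\<close> is taken over reals and is informative only for
  a set bounded above; comparing \<open>N\<close> with the Euclidean norm supplies the
  bound.\<close>

lemma bdd_above_dual_norm: "bdd_above ((\<lambda>x. p \<bullet> x) ` {x. N x \<le> 1})"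
proof -
  obtain e where e: "0 < e" "\<And>x. e * norm x \<le> N x" using is_norm_ge_norm by blast
  have "p \<bullet> x \<le> norm p * (1 / e)" if "N x \<le> 1" for x
  proof -
    have "e * norm x \<le> 1" using e(2)[of x] that by simp
    then have "norm x \<le> 1 / e" using e by (simp add: field_simps)
    then show ?thesis using norm_cauchy_schwarz[of p x] mult_left_mono[of "norm x" "1/e" "norm p"]
      by simp
  qed
  then show ?thesis by (intro bdd_aboveI) auto
qed

lemma inner_le_dual_norm: "p \<bullet> x \<le> dual_norm N p * N x"
proof (cases "x = 0")
  case False
  then have pos: "0 < N x" using is_norm_nonneg[of x] is_norm_eq_0[of x] by auto
  then have "p \<bullet> (x /\<^sub>R N x) \<le> dual_norm N p"
    unfolding dual_norm_def by (intro cSUP_upper bdd_above_dual_norm) (simp add: is_norm_scale)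
  then show ?thesis using pos by (simp add: field_simps)
qed (simp add: is_norm_zero)

lemma dual_norm_le:
  assumes "\<And>x. p \<bullet> x \<le> r * N x" "0 \<le> r"
  shows "dual_norm N p \<le> r"
  unfolding dual_norm_def
proof (rule cSUP_least)
  show "{x. N x \<le> 1} \<noteq> {}" by (auto intro!: exI[of _ 0] simp: is_norm_zero)
  fix x assume "x \<in> {x. N x \<le> 1}"
  then show "p \<bullet> x \<le> r" using assms(1)[of x] mult_left_mono[of "N x" 1 r] assms(2) by simp
qed

lemma dual_norm_nonneg: "0 \<le> dual_norm N p"
proof -
  have "p \<bullet> 0 \<le> dual_norm N p"
    unfolding dual_norm_def by (intro cSUP_upper bdd_above_dual_norm) (simp add: is_norm_zero)
  then show ?thesis by simp
qed

end

section \<open>Penalized and constrained problems\<close>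

text \<open>The subgradient inequality is written with \<open>L\<close> applied to points, so that
  no adjoint occurs; the witness \<open>a\<close> makes finiteness of \<open>\<Phi>\<close> at
  \<open>x\<close> part of the notion.\<close>

definition fenchel_pair ::
  "(real^'n \<Rightarrow> ereal) \<Rightarrow> real^'n^'m \<Rightarrow> real^'n \<Rightarrow> real^'m \<Rightarrow> bool" where
  "fenchel_pair \<Phi> L x p \<longleftrightarrow>
     (\<exists>a. \<Phi> x = ereal a \<and> (\<forall>y. ereal (a + p \<bullet> (L *v x) - p \<bullet> (L *v y)) \<le> \<Phi> y))"

text \<open>This is the interface between the structural setting and the duality argument;
  \<open>K\<close> will be \<open>X2\<close>. Compactness is asked of a truncated epigraph, so that
  minimization only involves continuous functions of \<open>(x, s)\<close>. Of differentiability,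
  \<open>smooth\<close> retains that \<open>x\<close> alone determines the number
  \<open>p \<bullet> (L *v x)\<close>.\<close>

locale homogeneous_penalization =
  fixes \<Phi> :: "real^'n \<Rightarrow> ereal" and L :: "real^'n^'m" and N :: "real^'m \<Rightarrow> real"
    and K :: "(real^'n) set"
  assumes norm: "is_norm N"
    and not_MInf: "\<Phi> x \<noteq> -\<infinity>"
    and convex_epi: "convex {(x, s). \<Phi> x \<le> ereal s}"
    and compact_sublevel: "compact {(x, s). \<Phi> x \<le> ereal s \<and> s \<le> \<alpha> \<and> N (L *v x) \<le> \<beta>}"
    and ex_minimizer: "\<exists>a. \<forall>y. \<Phi> a \<le> \<Phi> y"
    and slater: "0 < \<tau> \<Longrightarrow> \<exists>x s. \<Phi> x = ereal s \<and> N (L *v x) < \<tau>"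
    and subspace_K: "subspace K"
    and translate: "k \<in> K \<Longrightarrow> \<Phi> (x + k) = \<Phi> x"
    and strict: "\<lbrakk>\<Phi> x = ereal a; \<Phi> y = ereal b; x - y \<notin> K\<rbrakk>
      \<Longrightarrow> \<Phi> ((1/2) *\<^sub>R x + (1/2) *\<^sub>R y) < ereal ((a + b) / 2)"
    and smooth: "\<lbrakk>fenchel_pair \<Phi> L x p; fenchel_pair \<Phi> L x p'\<rbrakk>
      \<Longrightarrow> p \<bullet> (L *v x) = p' \<bullet> (L *v x)"
begin

abbreviation h :: "real^'n \<Rightarrow> real" where "h x \<equiv> N (L *v x)"

abbreviation dn :: "real^'m \<Rightarrow> real" where "dn \<equiv> dual_norm N"

definition \<psi> :: "real^'m \<Rightarrow> ereal" where "\<psi> = (\<lambda>p. conjugate \<Phi> (- (transpose L *v p)))"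

abbreviation fp :: "real^'n \<Rightarrow> real^'m \<Rightarrow> bool" where "fp \<equiv> fenchel_pair \<Phi> L"

lemmas norm_nonneg = is_norm_nonneg[OF norm]
  and norm_scale = is_norm_scale[OF norm]
  and norm_0 = is_norm_zero[OF norm]
  and inner_le = inner_le_dual_norm[OF norm]
  and dn_nonneg = dual_norm_nonneg[OF norm]

lemma SOL_P1: "x \<in> SOL (P1 \<Phi> L N \<tau>) \<longleftrightarrow> h x \<le> \<tau> \<and> (\<forall>y. h y \<le> \<tau> \<longrightarrow> \<Phi> x \<le> \<Phi> y)"
  and SOL_P2: "x \<in> SOL (P2 \<Phi> L N \<mu>) \<longleftrightarrow>
    (\<forall>y. \<Phi> x + ereal (\<mu> * h x) \<le> \<Phi> y + ereal (\<mu> * h y))"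
  and SOL_D1: "p \<in> SOL (D1 \<Phi> L N \<tau>) \<longleftrightarrow>
    (\<forall>q. \<psi> p + ereal (\<tau> * dn p) \<le> \<psi> q + ereal (\<tau> * dn q))"
  and SOL_D2: "p \<in> SOL (D2 \<Phi> L N \<mu>) \<longleftrightarrow> dn p \<le> \<mu> \<and> (\<forall>q. dn q \<le> \<mu> \<longrightarrow> \<psi> p \<le> \<psi> q)"
  and argmin_iff: "x \<in> argmin \<Phi> \<longleftrightarrow> (\<forall>y. \<Phi> x \<le> \<Phi> y)"
  and argmin_dual_iff: "p \<in> argmin \<psi> \<longleftrightarrow> (\<forall>q. \<psi> p \<le> \<psi> q)"
  by (auto simp: SOL_def P1_def P2_def D1_def D2_def argmin_def \<psi>_def)

section \<open>Weak duality and Fenchel pairs\<close>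

lemma weak_duality:
  assumes "\<Phi> x = ereal a"
  shows "ereal (- (p \<bullet> (L *v x)) - a) \<le> \<psi> p"
proof -
  have "ereal ((- (transpose L *v p)) \<bullet> x) - \<Phi> x \<le> \<psi> p"
    unfolding \<psi>_def conjugate_def by (rule SUP_upper) simp
  then show ?thesis using assms by (simp add: dot_lmul_matrix)
qed

lemma conj_not_MInf: "\<psi> p \<noteq> -\<infinity>"
proof -
  obtain x s where "\<Phi> x = ereal s" using slater[of 1] by auto
  then show ?thesis using weak_duality[of x s p] by auto
qed

text \<open>Equality case of the Fenchel-Young inequality: the subgradient inequality says that the
  term at \<open>x\<close> dominates every other term of the supremum.\<close>

lemma fp_conj:
  assumes "fp x p" "\<Phi> x = ereal a"
  shows "\<psi> p = ereal (- (p \<bullet> (L *v x)) - a)"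
proof (rule antisym[OF _ weak_duality[OF assms(2)]])
  show "\<psi> p \<le> ereal (- (p \<bullet> (L *v x)) - a)"
    unfolding \<psi>_def conjugate_def
  proof (rule SUP_least)
    fix y
    have "ereal (a + p \<bullet> (L *v x) - p \<bullet> (L *v y)) \<le> \<Phi> y"
      using assms by (auto simp: fenchel_pair_def)
    then show "ereal ((- (transpose L *v p)) \<bullet> y) - \<Phi> y \<le> ereal (- (p \<bullet> (L *v x)) - a)"
      by (cases "\<Phi> y") (auto simp: dot_lmul_matrix)
  qed
qed

text \<open>Converse of \<open>fp_conj\<close>: chaining weak duality at \<open>y\<close> with the
  assumed bound leaves exactly the subgradient inequality.\<close>

lemma conj_fp:
  assumes "\<Phi> x = ereal a" "\<psi> p \<le> ereal (- (p \<bullet> (L *v x)) - a)"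
  shows "fp x p"
  unfolding fenchel_pair_def
proof (intro exI[of _ a] conjI assms(1) allI)
  fix y
  show "ereal (a + p \<bullet> (L *v x) - p \<bullet> (L *v y)) \<le> \<Phi> y"
  proof (cases "\<Phi> y")
    case (real b)
    then show ?thesis using order_trans[OF weak_duality[OF real, of p] assms(2)] by simp
  qed (use not_MInf[of y] in auto)
qed

lemma fp_finite: assumes "fp x p" obtains a where "\<Phi> x = ereal a"
  using assms by (auto simp: fenchel_pair_def)

lemma P1_finite: assumes "x \<in> SOL (P1 \<Phi> L N \<tau>)" "0 < \<tau>" obtains a where "\<Phi> x = ereal a"
proof -
  obtain y s where "\<Phi> y = ereal s" "h y < \<tau>" using slater[OF assms(2)] by auto
  then have "\<Phi> x \<le> ereal s" using assms SOL_P1 less_imp_le by metis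
  then show thesis using that not_MInf[of x] by (cases "\<Phi> x") auto
qed

lemma P2_finite: assumes "x \<in> SOL (P2 \<Phi> L N \<mu>)" obtains a where "\<Phi> x = ereal a"
proof -
  obtain y s where "\<Phi> y = ereal s" using slater[of 1] by auto
  moreover have "\<Phi> x + ereal (\<mu> * h x) \<le> \<Phi> y + ereal (\<mu> * h y)" using assms SOL_P2 by blast
  ultimately have "\<Phi> x + ereal (\<mu> * h x) \<le> ereal (s + \<mu> * h y)" by simp
  then show thesis using that not_MInf[of x] by (cases "\<Phi> x") auto
qed

section \<open>Uniqueness of solutions modulo \<open>K\<close>\<close>

text \<open>Common core of the uniqueness proofs. Here \<open>G\<close> is a penalty that is convex
  at the midpoint, and \<open>min\<close> says that the midpoint does not improve on the average of
  the two penalized values; strict convexity outside \<open>K\<close> would improve on it. It is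
  used with \<open>G\<close> zero, a multiple of \<open>h\<close>, and linear.\<close>

lemma same_class:
  assumes fin: "\<Phi> x = ereal a" "\<Phi> y = ereal b"
    and G: "G ((1/2) *\<^sub>R x + (1/2) *\<^sub>R y) \<le> (G x + G y) / 2"
    and min: "ereal (((a + G x) + (b + G y)) / 2 - G ((1/2) *\<^sub>R x + (1/2) *\<^sub>R y))
      \<le> \<Phi> ((1/2) *\<^sub>R x + (1/2) *\<^sub>R y)"
  shows "x - y \<in> K"
proof (rule ccontr)
  assume "x - y \<notin> K"
  from le_less_trans[OF min strict[OF fin this]]
  have "((a + G x) + (b + G y)) / 2 - G ((1/2) *\<^sub>R x + (1/2) *\<^sub>R y) < (a + b) / 2"
    by simp
  then show False using G by (simp add: field_simps)
qed

lemma h_mid: "h ((1/2) *\<^sub>R x + (1/2) *\<^sub>R y) \<le> (h x + h y) / 2"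
proof -
  have "h ((1/2) *\<^sub>R x + (1/2) *\<^sub>R y) = N ((1/2) *\<^sub>R (L *v x) + (1/2) *\<^sub>R (L *v y))"
    by (simp add: matrix_vector_right_distrib matrix_vector_mult_scaleR)
  also have "\<dots> \<le> (h x + h y) / 2"
    using is_norm_triangle[OF norm, of "(1/2) *\<^sub>R (L *v x)" "(1/2) *\<^sub>R (L *v y)"]
    by (simp add: norm_scale)
  finally show ?thesis .
qed

lemma P1_unique:
  assumes "x \<in> SOL (P1 \<Phi> L N \<tau>)" "y \<in> SOL (P1 \<Phi> L N \<tau>)" "0 < \<tau>"
  shows "x - y \<in> K"
proof -
  obtain a where a: "\<Phi> x = ereal a" using P1_finite assms by metis
  have "\<Phi> y = \<Phi> x" using assms by (auto simp: SOL_P1 intro!: antisym)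
  moreover have "h ((1/2) *\<^sub>R x + (1/2) *\<^sub>R y) \<le> \<tau>"
    using h_mid[of x y] assms by (simp add: SOL_P1)
  then have "\<Phi> x \<le> \<Phi> ((1/2) *\<^sub>R x + (1/2) *\<^sub>R y)" using assms by (auto simp: SOL_P1)
  ultimately show ?thesis using same_class[of x a y a "\<lambda>_. 0"] a by simp
qed

lemma P2_unique:
  assumes "x \<in> SOL (P2 \<Phi> L N \<mu>)" "y \<in> SOL (P2 \<Phi> L N \<mu>)" "0 \<le> \<mu>"
  shows "x - y \<in> K"
proof -
  let ?z = "(1/2) *\<^sub>R x + (1/2) *\<^sub>R y"
  obtain a b where ab: "\<Phi> x = ereal a" "\<Phi> y = ereal b" using P2_finite assms by metis
  have "\<Phi> x + ereal (\<mu> * h x) = \<Phi> y + ereal (\<mu> * h y)"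
    using assms by (auto simp: SOL_P2 intro!: antisym)
  then have eq: "a + \<mu> * h x = b + \<mu> * h y" using ab by simp
  have "\<Phi> x + ereal (\<mu> * h x) \<le> \<Phi> ?z + ereal (\<mu> * h ?z)"
    using assms by (auto simp: SOL_P2)
  then have "ereal (((a + \<mu> * h x) + (b + \<mu> * h y)) / 2 - \<mu> * h ?z) \<le> \<Phi> ?z"
    using ab eq by (cases "\<Phi> ?z") (auto simp: field_simps)
  moreover have "\<mu> * h ?z \<le> (\<mu> * h x + \<mu> * h y) / 2"
    using mult_left_mono[OF h_mid[of x y] assms(3)] by (simp add: algebra_simps)
  ultimately show ?thesis using same_class[of x a y b "\<lambda>x. \<mu> * h x"] ab by simp
qed

text \<open>Both points minimize \<open>\<Phi>\<close> plus the linear term given by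
  \<open>p\<close>, for which the midpoint condition on \<open>G\<close> is an equality.\<close>

lemma fp_same_class:
  assumes "fp x p" "fp y p"
  shows "x - y \<in> K"
proof -
  let ?z = "(1/2) *\<^sub>R x + (1/2) *\<^sub>R y"
  let ?G = "\<lambda>x. p \<bullet> (L *v x)"
  obtain a b where ab: "\<Phi> x = ereal a" "\<Phi> y = ereal b" using fp_finite assms by metis
  have "ereal (a + ?G x - ?G ?z) \<le> \<Phi> ?z" "ereal (b + ?G y - ?G ?z) \<le> \<Phi> ?z"
    using assms ab by (auto simp: fenchel_pair_def)
  then have min: "ereal (((a + ?G x) + (b + ?G y)) / 2 - ?G ?z) \<le> \<Phi> ?z"
    by (cases "\<Phi> ?z") (auto simp: field_simps)
  have G: "?G ?z = (?G x + ?G y) / 2"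
    by (simp add: matrix_vector_right_distrib matrix_vector_mult_scaleR inner_add_right)
  show ?thesis by (rule same_class[where G = ?G, OF ab eq_refl[OF G] min])
qed

text \<open>Along \<open>k\<close> the function \<open>\<Phi>\<close> is constant, so an affine
  minorant touching it at \<open>x\<close> must have slope zero in this direction.\<close>

lemma fp_orthogonal_K:
  assumes "fp x p" "k \<in> K"
  shows "p \<bullet> (L *v k) = 0"
proof -
  obtain a where a: "\<Phi> x = ereal a" using fp_finite assms by metis
  have "0 \<le> t * (p \<bullet> (L *v k))" for t
  proof -
    have "\<Phi> (x + t *\<^sub>R k) = ereal a"
      using translate subspace_scale[OF subspace_K] assms a by metis
    moreover have "ereal (a + p \<bullet> (L *v x) - p \<bullet> (L *v (x + t *\<^sub>R k))) \<le> \<Phi> (x + t *\<^sub>R k)"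
      using assms a by (auto simp: fenchel_pair_def)
    ultimately show ?thesis
      by (simp add: matrix_vector_right_distrib matrix_vector_mult_scaleR inner_add_right)
  qed
  from this[of 1] this[of "-1"] show ?thesis by simp
qed

text \<open>Moving along \<open>K\<close> changes neither \<open>\<Phi>\<close> nor the pairing with
  \<open>p\<close>. Hence \<open>p\<close> is also a multiplier at \<open>y\<close>, where
  \<open>smooth\<close> compares it with \<open>q\<close>.\<close>

lemma fp_inner_unique:
  assumes "fp x p" "fp y q" "x - y \<in> K"
  shows "p \<bullet> (L *v x) = q \<bullet> (L *v y)"
proof -
  have xy: "x = y + (x - y)" by simp
  have p0: "p \<bullet> (L *v (x - y)) = 0" using fp_orthogonal_K assms by blast
  then have eq: "p \<bullet> (L *v x) = p \<bullet> (L *v y)"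
    by (simp add: matrix_vector_mult_diff_distrib inner_diff_right)
  have "\<Phi> x = \<Phi> y" using translate[OF assms(3), of y] by simp
  then have "fp y p" using assms(1) eq by (auto simp: fenchel_pair_def)
  then show ?thesis using smooth[OF _ assms(2)] eq by simp
qed

text \<open>Fermat's rule; a point of finite value supplies the finiteness that
  \<open>fenchel_pair\<close> demands.\<close>

lemma fp_argmin: "fp x 0 \<longleftrightarrow> x \<in> argmin \<Phi>"
proof
  assume "x \<in> argmin \<Phi>"
  moreover obtain y s where "\<Phi> y = ereal s" using slater[of 1] by auto
  ultimately have "\<Phi> x \<le> ereal s" by (metis argmin_iff)
  then obtain a where "\<Phi> x = ereal a" using not_MInf[of x] by (cases "\<Phi> x") auto
  then show "fp x 0" using \<open>x \<in> argmin \<Phi>\<close> by (auto simp: fenchel_pair_def argmin_iff)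
qed (auto simp: fenchel_pair_def argmin_iff)

section \<open>Existence of multipliers\<close>

text \<open>This set stands in for the epigraph of the value function that sends \<open>y\<close> to
  the infimum of \<open>\<Phi>\<close> over the fibre \<open>L x = y\<close>; as an image it is
  convex at once and does not presuppose that the infimum is attained.\<close>

definition epi_image :: "((real^'m) \<times> real) set" where
  "epi_image = (\<lambda>(x, s). (L *v x, s)) ` {(x, s). \<Phi> x \<le> ereal s}"

lemma convex_epi_image: "convex epi_image"
proof -
  have "linear (\<lambda>(x, s). (L *v x, s :: real))"
    by (rule linearI) (auto simp: matrix_vector_right_distrib matrix_vector_mult_scaleR)
  then show ?thesis unfolding epi_image_def by (intro convex_linear_image convex_epi)
qed

lemma mem_epi_image: "(y, s) \<in> epi_image \<longleftrightarrow> (\<exists>x. y = L *v x \<and> \<Phi> x \<le> ereal s)"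
  by (auto simp: epi_image_def image_iff)

text \<open>The sandwich is applied with the constant optimal value \<open>a\<close> on the ball of
  radius \<open>\<tau>\<close>. Optimality keeps \<open>epi_image\<close> above it there, and the
  Slater point provides the required interior point.\<close>

lemma ex_multiplier_P1:
  assumes x: "x \<in> SOL (P1 \<Phi> L N \<tau>)" and \<tau>: "0 < \<tau>"
  obtains p where "fp x p" "p \<bullet> (L *v x) = \<tau> * dn p"
proof -
  let ?W = "{y. N y \<le> \<tau>}"
  obtain a where a: "\<Phi> x = ereal a" using P1_finite x \<tau> by metis
  obtain x0 s0 where x0: "\<Phi> x0 = ereal s0" "h x0 < \<tau>" using slater[OF \<tau>] by auto
  have "convex ?W"
  proof (rule convexI)
    fix y z and u v :: real
    assume *: "y \<in> ?W" "z \<in> ?W" "0 \<le> u" "0 \<le> v" "u + v = 1"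
    have "N (u *\<^sub>R y + v *\<^sub>R z) \<le> u * N y + v * N z"
      using is_norm_triangle[OF norm, of "u *\<^sub>R y" "v *\<^sub>R z"] *(3,4) by (simp add: norm_scale)
    also have "\<dots> \<le> \<tau>" using *(1,2) by (intro convex_bound_le[OF _ _ *(3-5)]) simp_all
    finally show "u *\<^sub>R y + v *\<^sub>R z \<in> ?W" by simp
  qed
  then have W: "concave_on ?W (\<lambda>_. a)" by (simp add: concave_on_const)
  have "open {y. N y < \<tau>}"
    using continuous_on_is_norm[OF norm] by (intro open_Collect_less) auto
  then have int: "L *v x0 \<in> interior ?W"
    using x0 by (intro interiorI[of "{y. N y < \<tau>}"]) auto
  have ge: "a \<le> s" if H: "(y, s) \<in> epi_image" "y \<in> ?W" for y s
  proof -
    obtain z where "y = L *v z" "\<Phi> z \<le> ereal s" using H(1) by (auto simp: mem_epi_image)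
    then have "\<Phi> x \<le> \<Phi> z" using x H(2) by (simp add: SOL_P1)
    from order_trans[OF this \<open>\<Phi> z \<le> ereal s\<close>] have "\<Phi> x \<le> ereal s" .
    then show ?thesis using a by simp
  qed
  have mem: "(L *v x0, s0) \<in> epi_image" using x0 by (auto simp: mem_epi_image)
  obtain q where q: "\<And>z s y. (z, s) \<in> epi_image \<Longrightarrow> y \<in> ?W \<Longrightarrow> q \<bullet> y + a \<le> q \<bullet> z + s"
  proof (rule sandwich_affine[OF convex_epi_image W _ mem int])
    show "a \<le> s" if "(y, s) \<in> epi_image" "y \<in> ?W" for y s using that by (rule ge)
    fix q assume "\<And>z s y. (z, s) \<in> epi_image \<Longrightarrow> y \<in> ?W \<Longrightarrow> q \<bullet> y + a \<le> q \<bullet> z + s"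
    then show thesis by (rule that)
  qed
  have xW: "L *v x \<in> ?W" using x by (simp add: SOL_P1)
  have "fp x q"
    unfolding fenchel_pair_def
  proof (intro exI[of _ a] conjI a allI)
    fix y
    show "ereal (a + q \<bullet> (L *v x) - q \<bullet> (L *v y)) \<le> \<Phi> y"
    proof (cases "\<Phi> y")
      case (real b)
      then have "(L *v y, b) \<in> epi_image" by (auto simp: mem_epi_image)
      from q[OF this xW] show ?thesis using real by simp
    qed (use not_MInf[of y] in auto)
  qed
  moreover have "q \<bullet> (L *v x) = \<tau> * dn q"
  proof (rule antisym)
    have "q \<bullet> (L *v x) \<le> dn q * h x" by (rule inner_le)
    also have "\<dots> \<le> dn q * \<tau>" using xW dn_nonneg by (intro mult_left_mono) auto
    finally show "q \<bullet> (L *v x) \<le> \<tau> * dn q" by (simp add: mult.commute)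
    have xm: "(L *v x, a) \<in> epi_image" using a by (auto simp: mem_epi_image)
    \<comment> \<open>Inserting the epigraph point over \<open>L *v x\<close> shows that
      \<open>L *v x\<close> maximizes \<open>q\<close> over the ball; scaling the unit ball by
      \<open>\<tau>\<close> then turns this maximum into \<open>\<tau> * dn q\<close>.\<close>
    have le: "q \<bullet> y \<le> q \<bullet> (L *v x)" if "y \<in> ?W" for y using q[OF xm that] by simp
    have "dn q \<le> q \<bullet> (L *v x) / \<tau>"
      unfolding dual_norm_def
    proof (rule cSUP_least)
      show "{x. N x \<le> 1} \<noteq> {}" by (auto intro!: exI[of _ 0] simp: norm_0)
      fix y assume "y \<in> {x. N x \<le> 1}"
      then have "q \<bullet> (\<tau> *\<^sub>R y) \<le> q \<bullet> (L *v x)" using \<tau> by (intro le) (simp add: norm_scale)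
      then show "q \<bullet> y \<le> q \<bullet> (L *v x) / \<tau>" using \<tau> by (simp add: field_simps)
    qed
    then show "\<tau> * dn q \<le> q \<bullet> (L *v x)" using \<tau> by (simp add: field_simps)
  qed
  ultimately show thesis using that by blast
qed

text \<open>Here the sandwich uses the concave function \<open>\<theta>\<close> on the whole space.
  It lies below \<open>epi_image\<close> by optimality and touches it over
  \<open>L *v x\<close>.\<close>

lemma ex_multiplier_P2:
  assumes x: "x \<in> SOL (P2 \<Phi> L N \<mu>)" and \<mu>: "0 \<le> \<mu>"
  obtains p where "fp x p" "p \<bullet> (L *v x) = \<mu> * h x" "dn p \<le> \<mu>"
proof -
  obtain a where a: "\<Phi> x = ereal a" using P2_finite x by metis
  define \<theta> where "\<theta> y = a + \<mu> * h x - \<mu> * N y" for y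
  have "convex_on UNIV (\<lambda>y. \<mu> * N y + (- a - \<mu> * h x))"
    by (rule convex_on_add[OF convex_on_cmul[OF \<mu> convex_on_is_norm[OF norm]]])
      (simp add: convex_on_const)
  then have \<theta>: "concave_on UNIV \<theta>"
    by (simp add: concave_on_def \<theta>_def algebra_simps)
  have ge: "\<theta> y \<le> s" if H: "(y, s) \<in> epi_image" for y s
  proof -
    obtain z where z: "y = L *v z" "\<Phi> z \<le> ereal s" using H by (auto simp: mem_epi_image)
    have "\<Phi> x + ereal (\<mu> * h x) \<le> \<Phi> z + ereal (\<mu> * h z)" using x SOL_P2 by blast
    also have "\<dots> \<le> ereal s + ereal (\<mu> * h z)" using z by (intro add_right_mono)
    finally show ?thesis using a z by (simp add: \<theta>_def)
  qed
  have mem: "(L *v x, a) \<in> epi_image" using a by (auto simp: mem_epi_image)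
  obtain q where q: "\<And>z s y. (z, s) \<in> epi_image \<Longrightarrow> q \<bullet> y + \<theta> y \<le> q \<bullet> z + s"
    using sandwich_affine[OF convex_epi_image \<theta> ge mem] by auto
  have le: "q \<bullet> y - \<mu> * N y \<le> q \<bullet> (L *v x) - \<mu> * h x" for y
    using q[OF mem, of y] by (simp add: \<theta>_def)
  \<comment> \<open>The homogeneous function \<open>q \<bullet> y - \<mu> * N y\<close> is maximal
    at \<open>L *v x\<close>. Comparison with the double of this point and with 0 forces the maximum
    to be 0.\<close>
  have eq: "q \<bullet> (L *v x) = \<mu> * h x"
    using le[of "2 *\<^sub>R (L *v x)"] le[of 0] by (simp add: norm_scale norm_0)
  have "fp x q"
    unfolding fenchel_pair_def
  proof (intro exI[of _ a] conjI a allI)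
    fix y
    show "ereal (a + q \<bullet> (L *v x) - q \<bullet> (L *v y)) \<le> \<Phi> y"
    proof (cases "\<Phi> y")
      case (real b)
      then have "(L *v y, b) \<in> epi_image" by (auto simp: mem_epi_image)
      from q[OF this, of "L *v x"] show ?thesis using real by (simp add: \<theta>_def)
    qed (use not_MInf[of y] in auto)
  qed
  moreover have "dn q \<le> \<mu>"
    using le eq by (intro dual_norm_le[OF norm] \<mu>) simp
  ultimately show thesis using that eq by blast
qed

section \<open>Fenchel pairs with complementarity as optimality certificates, and conversely\<close>

text \<open>The pairing of any \<open>q\<close> with any feasible \<open>L *v y\<close> is at most
  \<open>\<tau> * dn q\<close>, and \<open>p\<close> attains this bound at \<open>x\<close>. The
  dual value of \<open>p\<close> is therefore \<open>-a\<close>, which weak duality makes a lower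
  bound for all dual values.\<close>

lemma optimal_P1_D1:
  assumes "fp x p" "p \<bullet> (L *v x) = \<tau> * dn p" "h x \<le> \<tau>" "0 \<le> \<tau>"
  shows "x \<in> SOL (P1 \<Phi> L N \<tau>)" "p \<in> SOL (D1 \<Phi> L N \<tau>)"
proof -
  obtain a where a: "\<Phi> x = ereal a" using fp_finite assms by metis
  have bound: "q \<bullet> (L *v y) \<le> \<tau> * dn q" if "h y \<le> \<tau>" for y q
    using inner_le[of q "L *v y"] mult_left_mono[OF that dn_nonneg[of q]] by (simp add: mult.commute)
  have "\<Phi> x \<le> \<Phi> y" if "h y \<le> \<tau>" for y
  proof -
    have "ereal (a + p \<bullet> (L *v x) - p \<bullet> (L *v y)) \<le> \<Phi> y"
      using assms a by (auto simp: fenchel_pair_def)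
    then show ?thesis using bound[OF that, of p] assms(2) a by (auto intro: order_trans[rotated])
  qed
  then show "x \<in> SOL (P1 \<Phi> L N \<tau>)" using assms by (simp add: SOL_P1)
  have "\<psi> p + ereal (\<tau> * dn p) \<le> \<psi> q + ereal (\<tau> * dn q)" for q
  proof -
    have "\<psi> p + ereal (\<tau> * dn p) = ereal (- a)" using fp_conj[OF assms(1) a] assms(2) by simp
    also have "\<dots> \<le> ereal (- (q \<bullet> (L *v x)) - a) + ereal (\<tau> * dn q)"
      using bound[OF assms(3), of q] by simp
    also have "\<dots> \<le> \<psi> q + ereal (\<tau> * dn q)" by (intro add_right_mono weak_duality a)
    finally show ?thesis .
  qed
  then show "p \<in> SOL (D1 \<Phi> L N \<tau>)" by (simp add: SOL_D1)
qed

text \<open>Mirror image of \<open>optimal_P1_D1\<close>: now the pairing is at most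
  \<open>\<mu> * h y\<close> for every feasible \<open>q\<close>, and the norm bound restricts the
  dual variable instead of the primal one.\<close>

lemma optimal_P2_D2:
  assumes "fp x p" "p \<bullet> (L *v x) = \<mu> * h x" "dn p \<le> \<mu>"
  shows "x \<in> SOL (P2 \<Phi> L N \<mu>)" "p \<in> SOL (D2 \<Phi> L N \<mu>)"
proof -
  obtain a where a: "\<Phi> x = ereal a" using fp_finite assms by metis
  have bound: "q \<bullet> (L *v y) \<le> \<mu> * h y" if "dn q \<le> \<mu>" for y q
    using inner_le[of q "L *v y"] mult_right_mono[OF that norm_nonneg[of "L *v y"]] by simp
  have "\<Phi> x + ereal (\<mu> * h x) \<le> \<Phi> y + ereal (\<mu> * h y)" for y
  proof -
    have "\<Phi> x + ereal (\<mu> * h x) \<le> ereal (a + p \<bullet> (L *v x) - p \<bullet> (L *v y)) + ereal (\<mu> * h y)"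
      using bound[OF assms(3), of y] assms(2) a by simp
    also have "\<dots> \<le> \<Phi> y + ereal (\<mu> * h y)"
      using assms a by (intro add_right_mono) (auto simp: fenchel_pair_def)
    finally show ?thesis .
  qed
  then show "x \<in> SOL (P2 \<Phi> L N \<mu>)" by (simp add: SOL_P2)
  have "\<psi> p \<le> \<psi> q" if "dn q \<le> \<mu>" for q
  proof -
    have "\<psi> p = ereal (- (\<mu> * h x) - a)" using fp_conj[OF assms(1) a] assms(2) by simp
    also have "\<dots> \<le> ereal (- (q \<bullet> (L *v x)) - a)" using bound[OF that, of x] by simp
    also have "\<dots> \<le> \<psi> q" by (intro weak_duality a)
    finally show ?thesis .
  qed
  then show "p \<in> SOL (D2 \<Phi> L N \<mu>)" using assms by (simp add: SOL_D2)
qed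

text \<open>The multiplier \<open>q\<close> of \<open>x\<close> shows that the dual minimum is at
  most \<open>-a\<close>. For \<open>p\<close> this squeezes weak duality and the dual norm
  inequality between equal bounds, so both become equalities.\<close>

lemma complementarity_P1_D1:
  assumes x: "x \<in> SOL (P1 \<Phi> L N \<tau>)" and p: "p \<in> SOL (D1 \<Phi> L N \<tau>)" and \<tau>: "0 < \<tau>"
  shows "fp x p" "p \<bullet> (L *v x) = \<tau> * dn p"
proof -
  obtain q where q: "fp x q" "q \<bullet> (L *v x) = \<tau> * dn q" using ex_multiplier_P1 x \<tau> by blast
  obtain a where a: "\<Phi> x = ereal a" using fp_finite q by metis
  have "\<psi> p + ereal (\<tau> * dn p) \<le> \<psi> q + ereal (\<tau> * dn q)" using p SOL_D1 by blast
  also have "\<dots> = ereal (- a)" using fp_conj[OF q(1) a] q(2) by simp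
  finally have le: "\<psi> p \<le> ereal (- (\<tau> * dn p) - a)"
    using conj_not_MInf[of p] by (cases "\<psi> p") auto
  have "dn p * h x \<le> dn p * \<tau>" using x dn_nonneg by (intro mult_left_mono) (auto simp: SOL_P1)
  then have bound: "p \<bullet> (L *v x) \<le> \<tau> * dn p"
    using inner_le[of p "L *v x"] by (simp add: mult.commute)
  then show fp: "fp x p" by (intro conj_fp[OF a] order_trans[OF le]) simp
  show "p \<bullet> (L *v x) = \<tau> * dn p" using le bound fp_conj[OF fp a] by simp
qed

lemma complementarity_P2_D2:
  assumes x: "x \<in> SOL (P2 \<Phi> L N \<mu>)" and p: "p \<in> SOL (D2 \<Phi> L N \<mu>)" and \<mu>: "0 \<le> \<mu>"
  shows "fp x p" "p \<bullet> (L *v x) = \<mu> * h x"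
proof -
  obtain q where q: "fp x q" "q \<bullet> (L *v x) = \<mu> * h x" "dn q \<le> \<mu>"
    using ex_multiplier_P2 x \<mu> by blast
  obtain a where a: "\<Phi> x = ereal a" using fp_finite q by metis
  have "\<psi> p \<le> \<psi> q" using p q SOL_D2 by blast
  also have "\<dots> = ereal (- (\<mu> * h x) - a)" using fp_conj[OF q(1) a] q(2) by simp
  finally have le: "\<psi> p \<le> ereal (- (\<mu> * h x) - a)" .
  have "dn p * h x \<le> \<mu> * h x" using p norm_nonneg by (intro mult_right_mono) (auto simp: SOL_D2)
  then have bound: "p \<bullet> (L *v x) \<le> \<mu> * h x" using inner_le[of p "L *v x"] by simp
  then show fp: "fp x p" by (intro conj_fp[OF a] order_trans[OF le]) simp
  show "p \<bullet> (L *v x) = \<mu> * h x" using le bound fp_conj[OF fp a] by simp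
qed

section \<open>Existence of primal solutions\<close>

text \<open>Weierstrass on a truncated epigraph: the real coordinate \<open>s\<close> replaces the
  extended value of \<open>\<Phi>\<close>, so the objective can be continuous although
  \<open>\<Phi>\<close> need not be.\<close>

lemma ex_min_on_sublevel:
  assumes "\<Phi> x0 \<le> ereal s0" "s0 \<le> \<alpha>" "h x0 \<le> \<beta>" and f: "continuous_on UNIV f"
  obtains x s where "\<Phi> x \<le> ereal s" "s \<le> \<alpha>" "h x \<le> \<beta>"
    "\<And>y t. \<lbrakk>\<Phi> y \<le> ereal t; t \<le> \<alpha>; h y \<le> \<beta>\<rbrakk> \<Longrightarrow> (f (x, s) :: real) \<le> f (y, t)"
proof -
  let ?C = "{(x, s). \<Phi> x \<le> ereal s \<and> s \<le> \<alpha> \<and> h x \<le> \<beta>}"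
  have "?C \<noteq> {}" using assms by auto
  from continuous_attains_inf[OF compact_sublevel this continuous_on_subset[OF f subset_UNIV]]
  obtain z where "z \<in> ?C" "\<forall>w\<in>?C. f z \<le> f w" by blast
  then show thesis using that[of "fst z" "snd z"] by (cases z) auto
qed

lemma continuous_on_h: "continuous_on S (\<lambda>z. h (fst z :: real^'n))"
proof -
  have "continuous_on S (\<lambda>z. L *v fst z)"
    by (rule continuous_on_compose2[OF matrix_vector_mult_linear_continuous_on[of UNIV L]
        continuous_on_fst[OF continuous_on_id]]) simp
  then show ?thesis
    by (rule continuous_on_compose2[OF continuous_on_is_norm[OF norm, of UNIV]]) simp
qed

lemma ex_P1:
  assumes "0 < \<tau>"
  obtains x where "x \<in> SOL (P1 \<Phi> L N \<tau>)"
proof -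
  obtain x0 s0 where x0: "\<Phi> x0 = ereal s0" "h x0 < \<tau>" using slater[OF assms] by auto
  obtain x s where x: "\<Phi> x \<le> ereal s" "s \<le> s0" "h x \<le> \<tau>"
    and min: "\<And>y t. \<lbrakk>\<Phi> y \<le> ereal t; t \<le> s0; h y \<le> \<tau>\<rbrakk> \<Longrightarrow> snd (x, s) \<le> snd (y, t)"
    using ex_min_on_sublevel[of x0 s0 s0 \<tau> snd] x0 continuous_on_snd[OF continuous_on_id] by auto
  have "\<Phi> x \<le> \<Phi> y" if "h y \<le> \<tau>" for y
  proof (cases "\<Phi> y")
    case (real b)
    then have "s \<le> b" using min[of y b] that x(2) by (cases "b \<le> s0") auto
    then show ?thesis using x(1) real by (metis ereal_less_eq(3) order_trans)
  qed (use not_MInf[of y] in auto)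
  then show thesis using that x SOL_P1 by blast
qed

lemma ex_P2:
  assumes \<mu>: "0 < \<mu>"
  obtains x where "x \<in> SOL (P2 \<Phi> L N \<mu>)"
proof -
  obtain x0 s0 where x0: "\<Phi> x0 = ereal s0" using slater[of 1] by auto
  obtain a where a: "\<And>y. \<Phi> a \<le> \<Phi> y" using ex_minimizer by auto
  then obtain m where m: "\<Phi> a = ereal m"
    using x0 not_MInf[of a] a[of x0] by (cases "\<Phi> a") auto
  define v where "v = s0 + \<mu> * h x0"
  \<comment> \<open>As \<open>\<Phi>\<close> is bounded below by \<open>m\<close>, a point outside
    the truncation at height \<open>v\<close> and penalty \<open>\<beta>\<close> has penalized value
    at least \<open>v\<close>, the value at \<open>x0\<close>.\<close>
  define \<beta> where "\<beta> = (v - m) / \<mu>"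
  have "m \<le> s0" using a[of x0] m x0 by simp
  then have "s0 \<le> v" "h x0 \<le> \<beta>"
    using \<mu> norm_nonneg[of "L *v x0"] by (auto simp: v_def \<beta>_def field_simps)
  moreover have "continuous_on UNIV (\<lambda>z. snd z + \<mu> * h (fst z))"
    by (intro continuous_intros continuous_on_h)
  ultimately obtain x s where x: "\<Phi> x \<le> ereal s" "s \<le> v" "h x \<le> \<beta>"
    and min: "\<And>y t. \<lbrakk>\<Phi> y \<le> ereal t; t \<le> v; h y \<le> \<beta>\<rbrakk> \<Longrightarrow> s + \<mu> * h x \<le> t + \<mu> * h y"
    using ex_min_on_sublevel[of x0 s0 v \<beta> "\<lambda>z. snd z + \<mu> * h (fst z)"] x0 by auto
  have "\<Phi> x + ereal (\<mu> * h x) \<le> \<Phi> y + ereal (\<mu> * h y)" for y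
  proof (cases "\<Phi> y")
    case (real b)
    have "s + \<mu> * h x \<le> b + \<mu> * h y"
    proof (cases "b \<le> v \<and> h y \<le> \<beta>")
      case False
      have "m \<le> b" using a[of y] m real by simp
      moreover have "0 \<le> \<mu> * h y" using \<mu> norm_nonneg by simp
      moreover have "\<not> h y \<le> \<beta> \<Longrightarrow> v - m < \<mu> * h y"
        using \<mu> by (simp add: \<beta>_def field_simps)
      ultimately have "v \<le> b + \<mu> * h y" using False by linarith
      moreover have "s + \<mu> * h x \<le> v"
        using min[of x0 s0] x0 \<open>s0 \<le> v\<close> \<open>h x0 \<le> \<beta>\<close> by (simp add: v_def)
      ultimately show ?thesis by simp
    qed (use min real in auto)
    then have "ereal s + ereal (\<mu> * h x) \<le> \<Phi> y + ereal (\<mu> * h y)" using real by simp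
    with add_right_mono[OF x(1)] show ?thesis by (rule order_trans)
  qed (use not_MInf[of y] in auto)
  then show thesis using that SOL_P2 by blast
qed

section \<open>The end points of the two parameter intervals\<close>

definition primal_bound :: ereal where "primal_bound = (INF x\<in>argmin \<Phi>. ereal (h x))"

definition dual_bound :: ereal where "dual_bound = (INF p\<in>argmin \<psi>. ereal (dn p))"

lemma primal_bound_le: "x \<in> argmin \<Phi> \<Longrightarrow> primal_bound \<le> ereal (h x)"
  unfolding primal_bound_def by (rule INF_lower)

lemma dual_bound_le: "p \<in> argmin \<psi> \<Longrightarrow> dual_bound \<le> ereal (dn p)"
  unfolding dual_bound_def by (rule INF_lower)

text \<open>Truncating the epigraph at the minimum \<open>m\<close> leaves only minimizers of
  \<open>\<Phi>\<close>, so \<open>h\<close> attains its least value among them. Attainment later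
  makes the bound on \<open>\<tau>\<close> strict.\<close>

lemma primal_bound_attained:
  obtains x where "x \<in> argmin \<Phi>" "primal_bound = ereal (h x)"
proof -
  obtain x0 s0 where x0: "\<Phi> x0 = ereal s0" using slater[of 1] by auto
  obtain a where a: "\<And>y. \<Phi> a \<le> \<Phi> y" using ex_minimizer by auto
  then obtain m where m: "\<Phi> a = ereal m"
    using x0 not_MInf[of a] a[of x0] by (cases "\<Phi> a") auto
  obtain x s where x: "\<Phi> x \<le> ereal s" "s \<le> m" "h x \<le> h a"
    and min: "\<And>y t. \<lbrakk>\<Phi> y \<le> ereal t; t \<le> m; h y \<le> h a\<rbrakk> \<Longrightarrow> h x \<le> h y"
    using ex_min_on_sublevel[of a m m "h a" "\<lambda>z. h (fst z)"] m continuous_on_h by auto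
  have "\<Phi> x \<le> \<Phi> a" using x m by (metis ereal_less_eq(3) order_trans)
  then have xa: "x \<in> argmin \<Phi>" using a by (auto simp: argmin_iff intro: order_trans)
  moreover have "h x \<le> h y" if "y \<in> argmin \<Phi>" for y
  proof -
    have "\<Phi> y \<le> ereal m" using that m unfolding argmin_iff by metis
    then show ?thesis using min[of y m] x(3) by (cases "h y \<le> h a") auto
  qed
  then have "ereal (h x) \<le> primal_bound" unfolding primal_bound_def by (intro INF_greatest) simp
  ultimately show thesis using that primal_bound_le[OF xa] by (metis antisym)
qed

section \<open>The relation between the two parameters\<close>

text \<open>Once the two norms are fixed, the single equality
  \<open>p \<bullet> (L *v x) = \<tau> * \<mu>\<close> is the complementarity condition of the
  constrained and of the penalized pair of problems at the same time.\<close>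

definition kkt :: "real \<Rightarrow> real \<Rightarrow> real^'n \<Rightarrow> real^'m \<Rightarrow> bool" where
  "kkt \<tau> \<mu> x p \<longleftrightarrow> fp x p \<and> h x = \<tau> \<and> dn p = \<mu> \<and> p \<bullet> (L *v x) = \<tau> * \<mu>"

text \<open>This relation becomes the graph of the bijection; its form treats both parameters alike,
  so that single-valuedness can be shown from either side.\<close>

definition linked :: "real \<Rightarrow> real \<Rightarrow> bool" where
  "linked \<tau> \<mu> \<longleftrightarrow> 0 < \<tau> \<and> 0 < \<mu> \<and> (\<exists>x p. kkt \<tau> \<mu> x p)"

lemma linked_cases:
  assumes "linked \<tau> \<mu>"
  obtains x p where "kkt \<tau> \<mu> x p" "0 < \<tau>" "0 < \<mu>"
  using assms by (auto simp: linked_def)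

lemma kkt_optimal:
  assumes "kkt \<tau> \<mu> x p" "0 < \<tau>"
  shows "x \<in> SOL (P1 \<Phi> L N \<tau>)" "x \<in> SOL (P2 \<Phi> L N \<mu>)"
    "p \<in> SOL (D1 \<Phi> L N \<tau>)" "p \<in> SOL (D2 \<Phi> L N \<mu>)"
  using assms optimal_P1_D1[of x p \<tau>] optimal_P2_D2[of x p \<mu>]
  by (auto simp: kkt_def mult.commute)

text \<open>Uniqueness modulo \<open>K\<close> transfers the value \<open>\<tau> * \<mu>\<close> of
  the pairing from the linking pair to arbitrary solutions. Complementarity then yields
  \<open>dn p = \<mu>\<close>, and the dual norm inequality forces the constraint on
  \<open>x\<close> to be active.\<close>

lemma kkt_of_P1_D1:
  assumes R: "linked \<tau> \<mu>" and x: "x \<in> SOL (P1 \<Phi> L N \<tau>)" and p: "p \<in> SOL (D1 \<Phi> L N \<tau>)"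
  shows "kkt \<tau> \<mu> x p"
proof -
  obtain x0 p0 where 0: "kkt \<tau> \<mu> x0 p0" and pos: "0 < \<tau>" "0 < \<mu>" using R by (rule linked_cases)
  note fp = complementarity_P1_D1[OF x p pos(1)]
  have "x - x0 \<in> K" using P1_unique[OF x kkt_optimal(1)] 0 pos by blast
  then have eq: "p \<bullet> (L *v x) = \<tau> * \<mu>" using fp_inner_unique fp(1) 0 by (metis kkt_def)
  then have dn: "dn p = \<mu>" using fp(2) pos by simp
  have "\<tau> * \<mu> \<le> \<mu> * h x" using inner_le[of p "L *v x"] eq dn by simp
  then have "\<tau> \<le> h x" using pos by (simp add: mult.commute)
  then have "h x = \<tau>" using x by (simp add: SOL_P1)
  then show ?thesis using fp(1) eq dn by (simp add: kkt_def)
qed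

text \<open>As in \<open>kkt_of_P1_D1\<close> with the roles exchanged: complementarity determines
  \<open>h x\<close>, and the dual norm inequality forces the constraint on \<open>p\<close> to be
  active.\<close>

lemma kkt_of_P2_D2:
  assumes R: "linked \<tau> \<mu>" and x: "x \<in> SOL (P2 \<Phi> L N \<mu>)" and p: "p \<in> SOL (D2 \<Phi> L N \<mu>)"
  shows "kkt \<tau> \<mu> x p"
proof -
  obtain x0 p0 where 0: "kkt \<tau> \<mu> x0 p0" and pos: "0 < \<tau>" "0 < \<mu>" using R by (rule linked_cases)
  note fp = complementarity_P2_D2[OF x p less_imp_le[OF pos(2)]]
  have "x - x0 \<in> K" using P2_unique[OF x kkt_optimal(2)] 0 pos by simp
  then have eq: "p \<bullet> (L *v x) = \<tau> * \<mu>" using fp_inner_unique fp(1) 0 by (metis kkt_def)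
  then have hx: "h x = \<tau>" using fp(2) pos by simp
  have "\<tau> * \<mu> \<le> dn p * \<tau>" using inner_le[of p "L *v x"] eq hx by simp
  then have "\<mu> \<le> dn p" using pos by (simp add: mult.commute)
  then have "dn p = \<mu>" using p by (simp add: SOL_D2)
  then show ?thesis using fp(1) eq hx by (simp add: kkt_def)
qed

text \<open>The pair that links \<open>\<tau>\<close> with \<open>\<mu>'\<close> solves both
  problems for \<open>\<tau>\<close>, so its dual component also has dual norm
  \<open>\<mu>\<close>.\<close>

lemma linked_unique_right: assumes "linked \<tau> \<mu>" "linked \<tau> \<mu>'" shows "\<mu> = \<mu>'"
  using assms kkt_of_P1_D1[OF assms(1)] kkt_optimal by (metis linked_def kkt_def)

lemma linked_unique_left: assumes "linked \<tau> \<mu>" "linked \<tau>' \<mu>" shows "\<tau> = \<tau>'"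
  using assms kkt_of_P2_D2[OF assms(1)] kkt_optimal by (metis linked_def kkt_def)

text \<open>Below the bound a feasible point cannot minimize \<open>\<Phi>\<close>, so the
  multiplier of a solution is nonzero; a nonzero multiplier makes the constraint active.\<close>

lemma linked_left_total:
  assumes \<tau>: "0 < \<tau>" "ereal \<tau> < primal_bound"
  obtains \<mu> where "linked \<tau> \<mu>"
proof -
  obtain x where x: "x \<in> SOL (P1 \<Phi> L N \<tau>)" using ex_P1[OF \<tau>(1)] by blast
  obtain p where p: "fp x p" "p \<bullet> (L *v x) = \<tau> * dn p" using ex_multiplier_P1[OF x \<tau>(1)] by blast
  have hx: "h x \<le> \<tau>" using x by (simp add: SOL_P1)
  then have "ereal (h x) < primal_bound" using \<tau>(2) by (metis ereal_less_eq(3) le_less_trans)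
  then have "p \<noteq> 0" using p(1) fp_argmin primal_bound_le by (metis linorder_not_le)
  have "dn p \<noteq> 0"
  proof
    assume "dn p = 0"
    then have "p \<bullet> p \<le> 0" using inner_le[of p p] by simp
    then show False using \<open>p \<noteq> 0\<close> inner_gt_zero_iff[of p] by linarith
  qed
  then have pos: "0 < dn p" using dn_nonneg[of p] by simp
  have "\<tau> * dn p \<le> dn p * h x" using inner_le[of p "L *v x"] p(2) by simp
  then have "h x = \<tau>" using pos hx by (simp add: mult.commute)
  then have "kkt \<tau> (dn p) x p" using p by (simp add: kkt_def)
  then show thesis using that \<tau> pos by (auto simp: linked_def)
qed

text \<open>If \<open>L *v x\<close> vanished, weak duality at \<open>x\<close> would make
  \<open>p\<close> a minimizer of \<open>\<psi>\<close> with norm at most \<open>\<mu>\<close>,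
  against the choice of \<open>\<mu>\<close>. With \<open>h x\<close> positive, complementarity
  forces \<open>dn p = \<mu>\<close>.\<close>

lemma linked_right_total:
  assumes \<mu>: "0 < \<mu>" "ereal \<mu> < dual_bound"
  obtains \<tau> where "linked \<tau> \<mu>"
proof -
  obtain x where x: "x \<in> SOL (P2 \<Phi> L N \<mu>)" using ex_P2[OF \<mu>(1)] by blast
  obtain p where p: "fp x p" "p \<bullet> (L *v x) = \<mu> * h x" "dn p \<le> \<mu>"
    using ex_multiplier_P2[OF x] \<mu> by auto
  have "h x \<noteq> 0"
  proof
    assume "h x = 0"
    then have L0: "L *v x = 0" using is_norm_eq_0[OF norm] by simp
    obtain a where a: "\<Phi> x = ereal a" using fp_finite p by blast
    have "\<psi> p \<le> \<psi> q" for q using fp_conj[OF p(1) a] weak_duality[OF a, of q] L0 by simp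
    then have "dual_bound \<le> ereal (dn p)" by (intro dual_bound_le) (simp add: argmin_dual_iff)
    also have "\<dots> \<le> ereal \<mu>" using p by simp
    finally show False using \<mu> by simp
  qed
  then have pos: "0 < h x" using norm_nonneg[of "L *v x"] by simp
  have "\<mu> * h x \<le> dn p * h x" using inner_le[of p "L *v x"] p(2) by simp
  then have "dn p = \<mu>" using pos p(3) by simp
  then have "kkt (h x) \<mu> x p" using p by (simp add: kkt_def mult.commute)
  then show thesis using that \<mu> pos by (auto simp: linked_def)
qed

text \<open>Otherwise a minimizer of \<open>\<Phi>\<close> with least \<open>h\<close> would be
  feasible and hence solve the constrained problem. It would then have both \<open>p0\<close> and 0
  as multipliers, and \<open>smooth\<close> would give \<open>\<tau> * \<mu> = 0\<close>.\<close>

lemma linked_less_primal_bound: assumes R: "linked \<tau> \<mu>" shows "ereal \<tau> < primal_bound"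
proof (rule ccontr)
  assume "\<not> ereal \<tau> < primal_bound"
  moreover obtain a where a: "a \<in> argmin \<Phi>" "primal_bound = ereal (h a)" by (rule primal_bound_attained)
  ultimately have aP: "a \<in> SOL (P1 \<Phi> L N \<tau>)" by (simp add: SOL_P1 argmin_iff)
  obtain x0 p0 where 0: "kkt \<tau> \<mu> x0 p0" and pos: "0 < \<tau>" "0 < \<mu>" using R by (rule linked_cases)
  have "kkt \<tau> \<mu> a p0" using kkt_of_P1_D1[OF R aP] kkt_optimal[OF 0 pos(1)] by blast
  moreover have "fp a 0" using a fp_argmin by blast
  ultimately have "\<tau> * \<mu> = 0" using smooth[of a p0 0] by (simp add: kkt_def)
  then show False using pos by simp
qed

text \<open>Each penalized solution is compared with the other one; in the sum of the two
  inequalities the values of \<open>\<Phi>\<close> cancel.\<close>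

lemma linked_antimono:
  assumes "linked \<tau> \<mu>" "linked \<tau>' \<mu>'" "\<tau>' < \<tau>"
  shows "\<mu> \<le> \<mu>'"
proof -
  obtain x p where x: "kkt \<tau> \<mu> x p" "0 < \<tau>" using assms(1) linked_cases by metis
  obtain y q where y: "kkt \<tau>' \<mu>' y q" "0 < \<tau>'" using assms(2) linked_cases by metis
  obtain a b where ab: "\<Phi> x = ereal a" "\<Phi> y = ereal b"
    using fp_finite x y by (metis kkt_def)
  have "\<Phi> x + ereal (\<mu> * h x) \<le> \<Phi> y + ereal (\<mu> * h y)"
    "\<Phi> y + ereal (\<mu>' * h y) \<le> \<Phi> x + ereal (\<mu>' * h x)"
    using kkt_optimal(2)[OF x] kkt_optimal(2)[OF y] SOL_P2 by blast+
  then have "a + \<mu> * \<tau> \<le> b + \<mu> * \<tau>'" "b + \<mu>' * \<tau>' \<le> a + \<mu>' * \<tau>"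
    using x y ab by (auto simp: kkt_def)
  then have "\<mu> * (\<tau> - \<tau>') \<le> \<mu>' * (\<tau> - \<tau>')" by (simp add: algebra_simps)
  then show ?thesis using assms(3) by simp
qed

text \<open>The partner \<open>\<mu>'\<close> of \<open>\<tau> / 2\<close> is strictly larger than
  \<open>\<mu>\<close>, and no minimizer of \<open>\<psi>\<close> has norm below
  \<open>\<mu>'\<close>: such a point would solve the problem for \<open>\<mu>'\<close>, all of
  whose solutions have norm exactly \<open>\<mu>'\<close>. The detour gives strictness without a
  dual minimizer of least norm.\<close>

lemma linked_less_dual_bound: assumes R: "linked \<tau> \<mu>" shows "ereal \<mu> < dual_bound"
proof -
  have pos: "0 < \<tau>" using R by (simp add: linked_def)
  then have "ereal (\<tau> / 2) < primal_bound" by (intro less_trans[OF _ linked_less_primal_bound[OF R]]) simp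
  then obtain \<mu>' where R': "linked (\<tau> / 2) \<mu>'" using linked_left_total[of "\<tau> / 2"] pos by auto
  have "\<mu> \<le> \<mu>'" using linked_antimono[OF R R'] pos by simp
  moreover have "\<mu> \<noteq> \<mu>'" using linked_unique_left[OF R, of "\<tau> / 2"] R' pos by auto
  moreover have "ereal \<mu>' \<le> ereal (dn p)" if p: "p \<in> argmin \<psi>" for p
  proof (rule ccontr)
    assume "\<not> ereal \<mu>' \<le> ereal (dn p)"
    then have "p \<in> SOL (D2 \<Phi> L N \<mu>')" using p by (simp add: SOL_D2 argmin_dual_iff)
    moreover obtain x q where "kkt (\<tau> / 2) \<mu>' x q" "0 < \<tau> / 2" using R' linked_cases by metis
    ultimately have "kkt (\<tau> / 2) \<mu>' x p" using kkt_of_P2_D2[OF R'] kkt_optimal(2) by blast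
    then show False using \<open>\<not> ereal \<mu>' \<le> ereal (dn p)\<close> by (simp add: kkt_def)
  qed
  then have "ereal \<mu>' \<le> dual_bound" unfolding dual_bound_def by (rule INF_greatest)
  moreover have "ereal \<mu> < ereal \<mu>'" using calculation(1,2) by simp
  ultimately show ?thesis by (metis less_le_trans)
qed

lemma linked_finite_minimum:
  assumes R: "linked \<tau> \<mu>"
  shows "has_finite_minimum (P1 \<Phi> L N \<tau>)" "has_finite_minimum (P2 \<Phi> L N \<mu>)"
    "has_finite_minimum (D1 \<Phi> L N \<tau>)" "has_finite_minimum (D2 \<Phi> L N \<mu>)"
proof -
  obtain x p where x: "kkt \<tau> \<mu> x p" "0 < \<tau>" using R linked_cases by metis
  obtain a where a: "\<Phi> x = ereal a" using fp_finite x by (metis kkt_def)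
  have p: "conjugate \<Phi> (- (transpose L *v p)) = ereal (- (p \<bullet> (L *v x)) - a)"
    using fp_conj[OF _ a] x by (simp add: kkt_def \<psi>_def)
  note opt = kkt_optimal[OF x]
  show "has_finite_minimum (P1 \<Phi> L N \<tau>)"
    unfolding has_finite_minimum_def
    by (rule bexI[OF _ opt(1)]) (simp add: P1_def a)
  show "has_finite_minimum (P2 \<Phi> L N \<mu>)"
    unfolding has_finite_minimum_def
    by (rule bexI[OF _ opt(2)]) (simp add: P2_def a)
  show "has_finite_minimum (D1 \<Phi> L N \<tau>)"
    unfolding has_finite_minimum_def
    by (rule bexI[OF _ opt(3)]) (simp add: D1_def p del: transpose_matrix_vector)
  show "has_finite_minimum (D2 \<Phi> L N \<mu>)"
    unfolding has_finite_minimum_def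
    by (rule bexI[OF _ opt(4)]) (simp add: D2_def p del: transpose_matrix_vector)
qed

text \<open>Any solution of one problem, paired with a fixed optimal partner from the other space,
  is again a \<open>kkt\<close> pair and is therefore optimal for the companion problem too.\<close>

lemma linked_SOL_eq:
  assumes R: "linked \<tau> \<mu>"
  shows "SOL (P1 \<Phi> L N \<tau>) = SOL (P2 \<Phi> L N \<mu>)" "SOL (D1 \<Phi> L N \<tau>) = SOL (D2 \<Phi> L N \<mu>)"
proof -
  obtain x p where x: "kkt \<tau> \<mu> x p" "0 < \<tau>" using R linked_cases by metis
  note opt = kkt_optimal[OF x]
  show "SOL (P1 \<Phi> L N \<tau>) = SOL (P2 \<Phi> L N \<mu>)"
    using kkt_of_P1_D1[OF R _ opt(3)] kkt_of_P2_D2[OF R _ opt(4)] kkt_optimal x(2) by blast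
  show "SOL (D1 \<Phi> L N \<tau>) = SOL (D2 \<Phi> L N \<mu>)"
    using kkt_of_P1_D1[OF R opt(1)] kkt_of_P2_D2[OF R opt(2)] kkt_optimal x(2) by blast
qed

section \<open>Common solutions occur only for linked parameters\<close>

text \<open>An inactive constraint forces the multiplier to vanish, and Fermat's rule
  applies.\<close>

lemma argmin_of_P1_slack:
  assumes x: "x \<in> SOL (P1 \<Phi> L N \<tau>)" and h: "h x < \<tau>"
  shows "x \<in> argmin \<Phi>"
proof -
  have \<tau>: "0 < \<tau>" using h norm_nonneg[of "L *v x"] by simp
  obtain p where p: "fp x p" "p \<bullet> (L *v x) = \<tau> * dn p" using ex_multiplier_P1[OF x \<tau>] by blast
  have "(\<tau> - h x) * dn p \<le> 0" using inner_le[of p "L *v x"] p(2) by (simp add: algebra_simps)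
  then have "dn p \<le> 0" using h by (simp add: mult_le_0_iff)
  then have "p \<bullet> p \<le> 0" using inner_le[of p p] dn_nonneg[of p] by simp
  then have "p = 0" using inner_gt_zero_iff[of p] by linarith
  then show ?thesis using p(1) fp_argmin by simp
qed

text \<open>One parameter lies in its interval and has a partner. For given \<open>\<tau>\<close>,
  the multipliers of \<open>x\<close> in the two problems have equal pairing, which identifies
  \<open>\<mu>\<close> with the partner. For given \<open>\<mu>\<close>, \<open>x\<close> is not a
  minimizer of \<open>\<Phi>\<close>, so its constraint is active and \<open>\<tau>\<close> is the
  partner.\<close>

lemma linked_of_primal:
  assumes x: "x \<in> SOL (P1 \<Phi> L N \<tau>)" "x \<in> SOL (P2 \<Phi> L N \<mu>)" and nonneg: "0 \<le> \<mu>"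
    and range: "0 < \<tau> \<and> ereal \<tau> < primal_bound \<or> 0 < \<mu> \<and> ereal \<mu> < dual_bound"
  shows "linked \<tau> \<mu>"
  using range
proof
  assume \<tau>: "0 < \<tau> \<and> ereal \<tau> < primal_bound"
  then obtain \<mu>' where R: "linked \<tau> \<mu>'" using linked_left_total by blast
  then obtain x0 p0 where 0: "kkt \<tau> \<mu>' x0 p0" using linked_cases by metis
  have k: "kkt \<tau> \<mu>' x p0" using kkt_of_P1_D1[OF R x(1)] kkt_optimal(3)[OF 0] \<tau> by blast
  obtain p where p: "fp x p" "p \<bullet> (L *v x) = \<mu> * h x" using ex_multiplier_P2[OF x(2) nonneg] by blast
  have "\<mu> * \<tau> = \<tau> * \<mu>'" using smooth[OF p(1), of p0] k p(2) by (simp add: kkt_def)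
  then have "\<mu> = \<mu>'" using \<tau> by simp
  then show ?thesis using R by simp
next
  assume \<mu>: "0 < \<mu> \<and> ereal \<mu> < dual_bound"
  then obtain \<tau>' where R: "linked \<tau>' \<mu>" using linked_right_total by blast
  then obtain x0 p0 where 0: "kkt \<tau>' \<mu> x0 p0" "0 < \<tau>'" using linked_cases by metis
  have k: "kkt \<tau>' \<mu> x p0" using kkt_of_P2_D2[OF R x(2)] kkt_optimal(4)[OF 0] by blast
  then have hx: "h x = \<tau>'" by (simp add: kkt_def)
  then have "x \<notin> argmin \<Phi>" using linked_less_primal_bound[OF R] primal_bound_le by fastforce
  then have "\<not> h x < \<tau>" using argmin_of_P1_slack[OF x(1)] by blast
  then have "\<tau> = \<tau>'" using x(1) hx by (simp add: SOL_P1)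
  then show ?thesis using R by simp
qed

lemma linked_of_dual:
  assumes p: "p \<in> SOL (D1 \<Phi> L N \<tau>)" "p \<in> SOL (D2 \<Phi> L N \<mu>)" and nonneg: "0 \<le> \<tau>" "0 \<le> \<mu>"
    and range: "0 < \<tau> \<and> ereal \<tau> < primal_bound \<or> 0 < \<mu> \<and> ereal \<mu> < dual_bound"
  shows "linked \<tau> \<mu>"
proof (cases "0 < \<tau> \<and> ereal \<tau> < primal_bound")
  case True
  then obtain \<mu>' where R: "linked \<tau> \<mu>'" using linked_left_total by blast
  then obtain x0 p0 where 0: "kkt \<tau> \<mu>' x0 p0" "0 < \<tau>" "0 < \<mu>'" by (rule linked_cases)
  have k: "kkt \<tau> \<mu>' x0 p" using kkt_of_P1_D1[OF R _ p(1)] kkt_optimal(1)[OF 0(1,2)] by blast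
  then have dn: "dn p = \<mu>'" by (simp add: kkt_def)
  then have le: "\<mu>' \<le> \<mu>" using p(2) by (simp add: SOL_D2)
  \<comment> \<open>Complementarity for \<open>\<mu>\<close> needs a primal solution for
    \<open>\<mu>\<close> itself. Sharing the multiplier \<open>p\<close> then ties \<open>y\<close>
    to \<open>x0\<close> modulo \<open>K\<close>, which makes \<open>\<mu> * h y\<close> equal to
    the positive number \<open>\<tau> * \<mu>'\<close>.\<close>
  then obtain y where y: "y \<in> SOL (P2 \<Phi> L N \<mu>)" using ex_P2 0(3) by (metis less_le_trans)
  note fp = complementarity_P2_D2[OF y p(2) nonneg(2)]
  have "y - x0 \<in> K" using fp_same_class[OF fp(1)] k by (simp add: kkt_def)
  then have "\<mu> * h y = \<tau> * \<mu>'"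
    using fp_inner_unique[OF fp(1), of x0 p] k fp(2) by (simp add: kkt_def)
  moreover have "\<mu> * h y \<le> \<mu>' * h y" using inner_le[of p "L *v y"] fp(2) dn by simp
  ultimately have "\<mu> \<le> \<mu>'" using 0 norm_nonneg[of "L *v y"]
    by (metis less_le mult_eq_0_iff mult_le_cancel_right_pos)
  then show ?thesis using le R by simp
next
  case False
  then have \<mu>: "0 < \<mu>" "ereal \<mu> < dual_bound" using range by auto
  then obtain \<tau>' where R: "linked \<tau>' \<mu>" using linked_right_total by blast
  then obtain x0 p0 where 0: "kkt \<tau>' \<mu> x0 p0" "0 < \<tau>'" using linked_cases by metis
  have k: "kkt \<tau>' \<mu> x0 p" using kkt_of_P2_D2[OF R _ p(2)] kkt_optimal(2)[OF 0] by blast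
  then have dn: "dn p = \<mu>" by (simp add: kkt_def)
  show ?thesis
  proof (cases "\<tau> = 0")
    case True
    \<comment> \<open>Without a penalty the dual problem is plain minimization of
      \<open>\<psi>\<close>, and a minimizer cannot have norm \<open>\<mu>\<close> below
      \<open>dual_bound\<close>.\<close>
    then have "p \<in> argmin \<psi>" using p(1) by (simp add: SOL_D1 argmin_dual_iff flip: zero_ereal_def)
    then show ?thesis using dual_bound_le[of p] dn \<mu>(2) by auto
  next
    case tau: False
    then have "primal_bound \<le> ereal \<tau>" using False nonneg by auto
    moreover obtain a where a: "a \<in> argmin \<Phi>" "primal_bound = ereal (h a)" by (rule primal_bound_attained)
    ultimately have "a \<in> SOL (P1 \<Phi> L N \<tau>)" by (simp add: SOL_P1 argmin_iff)
    then have "fp a p" "p \<bullet> (L *v a) = \<tau> * dn p"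
      using complementarity_P1_D1[OF _ p(1)] nonneg tau by auto
    \<comment> \<open>For \<open>\<tau>\<close> beyond the primal bound, the solution
      \<open>a\<close> minimizes \<open>\<Phi>\<close> and hence also has the multiplier 0.\<close>
    then have "\<tau> * \<mu> = 0" using smooth[of a p 0] a(1) fp_argmin dn by simp
    then show ?thesis using tau \<mu> by simp
  qed
qed

section \<open>The bijection and its consequences\<close>

text \<open>\<open>linked\<close> is single-valued in both directions, reaches every point of both
  open intervals, and by the two strict bounds contains no other parameters. It is thus the graph of
  a bijection.\<close>

lemma ex_bij_linked:
  "\<exists>g. bij_betw g (open_from_0 primal_bound) (open_from_0 dual_bound) \<and>
    (\<forall>\<tau> \<mu>. (\<tau>, \<mu>) \<in> graph_on (open_from_0 primal_bound) g \<longleftrightarrow> linked \<tau> \<mu>)"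
proof -
  define g where "g \<tau> = (THE \<mu>. linked \<tau> \<mu>)" for \<tau>
  have g: "g \<tau> = \<mu>" if "linked \<tau> \<mu>" for \<tau> \<mu>
    unfolding g_def using that linked_unique_right by blast
  have mem: "\<tau> \<in> open_from_0 primal_bound" "\<mu> \<in> open_from_0 dual_bound" if "linked \<tau> \<mu>" for \<tau> \<mu>
    using linked_less_primal_bound[OF that] linked_less_dual_bound[OF that] that by (auto simp: open_from_0_def linked_def)
  have Rg: "linked \<tau> (g \<tau>)" if \<tau>: "\<tau> \<in> open_from_0 primal_bound" for \<tau>
  proof -
    obtain \<mu> where "linked \<tau> \<mu>" using linked_left_total \<tau> by (auto simp: open_from_0_def)
    then show ?thesis using g by simp
  qed
  have "bij_betw g (open_from_0 primal_bound) (open_from_0 dual_bound)"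
  proof (rule bij_betw_imageI)
    show "inj_on g (open_from_0 primal_bound)" using Rg linked_unique_left by (metis inj_onI)
    show "g ` open_from_0 primal_bound = open_from_0 dual_bound"
    proof (intro equalityI subsetI)
      fix \<mu> assume "\<mu> \<in> open_from_0 dual_bound"
      then obtain \<tau> where "linked \<tau> \<mu>" using linked_right_total by (auto simp: open_from_0_def)
      then show "\<mu> \<in> g ` open_from_0 primal_bound" using g mem by (metis imageI)
    next
      fix \<mu> assume "\<mu> \<in> g ` open_from_0 primal_bound"
      then show "\<mu> \<in> open_from_0 dual_bound" using Rg mem(2) by blast
    qed
  qed
  moreover have "(\<tau>, \<mu>) \<in> graph_on (open_from_0 primal_bound) g \<longleftrightarrow> linked \<tau> \<mu>" for \<tau> \<mu>
    using Rg g mem by (auto simp: graph_on_def)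
  ultimately show ?thesis by blast
qed

lemma finite_minima:
  assumes "\<tau> \<in> open_from_0 primal_bound" "\<mu> \<in> open_from_0 dual_bound"
  shows "has_finite_minimum (P1 \<Phi> L N \<tau>)" "has_finite_minimum (P2 \<Phi> L N \<mu>)"
    "has_finite_minimum (D1 \<Phi> L N \<tau>)" "has_finite_minimum (D2 \<Phi> L N \<mu>)"
proof -
  obtain \<mu>' where "linked \<tau> \<mu>'" using linked_left_total assms(1) by (auto simp: open_from_0_def)
  then show "has_finite_minimum (P1 \<Phi> L N \<tau>)" "has_finite_minimum (D1 \<Phi> L N \<tau>)"
    by (rule linked_finite_minimum)+
  obtain \<tau>' where "linked \<tau>' \<mu>" using linked_right_total assms(2) by (auto simp: open_from_0_def)
  then show "has_finite_minimum (P2 \<Phi> L N \<mu>)" "has_finite_minimum (D2 \<Phi> L N \<mu>)"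
    by (rule linked_finite_minimum)+
qed

lemma linked_solutions:
  assumes R: "linked \<tau> \<mu>"
    and x: "x \<in> SOL (P1 \<Phi> L N \<tau>) \<union> SOL (P2 \<Phi> L N \<mu>)"
    and p: "p \<in> SOL (D1 \<Phi> L N \<tau>) \<union> SOL (D2 \<Phi> L N \<mu>)"
  shows "\<tau> = h x \<and> \<mu> = dn p"
proof -
  have "x \<in> SOL (P1 \<Phi> L N \<tau>)" "p \<in> SOL (D1 \<Phi> L N \<tau>)" using x p linked_SOL_eq[OF R] by auto
  from kkt_of_P1_D1[OF R this] show ?thesis by (simp add: kkt_def)
qed

end

section \<open>The structural setting\<close>

lemma closed_epigraph:
  fixes f :: "'a::euclidean_space \<Rightarrow> ereal"
  assumes "lsc_on UNIV f"
  shows "closed {(x, s). f x \<le> ereal s}"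
  unfolding closed_sequential_limits
proof (intro allI impI)
  fix z and l :: "'a \<times> real"
  assume *: "(\<forall>n. z n \<in> {(x, s). f x \<le> ereal s}) \<and> z \<longlonglongrightarrow> l"
  then have epi: "f (fst (z n)) \<le> ereal (snd (z n))" for n by (metis case_prodE mem_Collect_eq fst_conv snd_conv)
  have lim: "(\<lambda>n. fst (z n)) \<longlonglongrightarrow> fst l" "(\<lambda>n. snd (z n)) \<longlonglongrightarrow> snd l"
    using * by (auto intro: tendsto_fst tendsto_snd)
  have "f (fst l) \<le> ereal (snd l)"
  proof (rule ccontr)
    assume "\<not> ?thesis"
    \<comment> \<open>A real level strictly between the limiting height and the value at the limit;
      along the tail of the sequence the heights fall below it while the values of \<open>f\<close>
      stay above it.\<close>
    then obtain r where r: "ereal (snd l) < ereal r" "ereal r < f (fst l)"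
      by (metis ereal_dense2 linorder_not_le)
    then have "ereal r < Liminf (at (fst l)) f" using assms by (auto simp: lsc_on_def intro: less_le_trans)
    then have "\<forall>\<^sub>F x in at (fst l). ereal r < f x" by (rule less_LiminfD)
    \<comment> \<open>\<open>Liminf\<close> along \<open>at\<close> ignores the limit point itself;
      the choice of \<open>r\<close> adds it back, as the sequence may hit that point.\<close>
    then have "\<forall>\<^sub>F x in nhds (fst l). ereal r < f x"
      using r by (auto simp: eventually_at_filter elim: eventually_mono)
    then have "\<forall>\<^sub>F n in sequentially. ereal r < f (fst (z n))"
      using lim(1) by (auto simp: filterlim_iff)
    moreover have "\<forall>\<^sub>F n in sequentially. snd (z n) < r"
      using lim(2) r by (intro order_tendstoD) auto
    ultimately have "\<forall>\<^sub>F n in sequentially. ereal r < f (fst (z n)) \<and> snd (z n) < r"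
      by (rule eventually_conj)
    then obtain n where n: "ereal r < f (fst (z n))" "snd (z n) < r"
      using eventually_happens'[OF sequentially_bot] by blast
    have "ereal r < ereal (snd (z n))" using n(1) epi[of n] by (rule less_le_trans)
    then show False using n by simp
  qed
  then show "l \<in> {(x, s). f x \<le> ereal s}" by (auto simp: case_prod_beta)
qed

lemma econvex_on_epi:
  assumes "econvex_on UNIV f" "f x \<le> ereal s" "f y \<le> ereal t" "0 < u" "u < 1"
  shows "f ((1 - u) *\<^sub>R x + u *\<^sub>R y) \<le> ereal ((1 - u) * s + u * t)"
proof -
  have "f ((1 - u) *\<^sub>R x + u *\<^sub>R y) \<le> ereal (1 - u) * f x + ereal u * f y"
    using assms by (auto simp: econvex_on_def)
  also have "\<dots> \<le> ereal (1 - u) * ereal s + ereal u * ereal t"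
    using assms by (intro add_mono ereal_mult_left_mono) auto
  finally show ?thesis by simp
qed

lemma convex_epigraph:
  fixes f :: "'a::euclidean_space \<Rightarrow> ereal"
  assumes "econvex_on UNIV f"
  shows "convex {(x, s). f x \<le> ereal s}"
  unfolding convex_alt
proof (intro ballI allI impI)
  fix z w :: "'a \<times> real" and u :: real
  assume *: "z \<in> {(x, s). f x \<le> ereal s}" "w \<in> {(x, s). f x \<le> ereal s}" "0 \<le> u \<and> u \<le> 1"
  obtain x s y t where z: "z = (x, s)" "w = (y, t)" by (cases z, cases w)
  consider "u = 0" | "u = 1" | "0 < u" "u < 1" using * by linarith
  then show "(1 - u) *\<^sub>R z + u *\<^sub>R w \<in> {(x, s). f x \<le> ereal s}"
    by cases (use * z econvex_on_epi[OF assms, of x s y t u] in auto)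
qed

text \<open>On the unit sphere around the minimizer, \<open>f\<close> exceeds its minimum by some
  \<open>\<delta> > 0\<close>. Convexity along rays from \<open>a\<close> turns this into growth at
  least linear with slope \<open>\<delta>\<close> outside the unit ball, which bounds the sublevel
  sets.\<close>

lemma bounded_sublevel_unique_minimizer:
  fixes f :: "'a::euclidean_space \<Rightarrow> ereal"
  assumes lsc: "lsc_on UNIV f" and conv: "econvex_on UNIV f" and X: "closed X" "convex X"
    and a: "a \<in> X" "f a = ereal m" and min: "\<And>y. y \<in> X \<Longrightarrow> y \<noteq> a \<Longrightarrow> f a < f y"
  shows "bounded {x \<in> X. f x \<le> ereal \<alpha>}"
proof -
  have "\<exists>\<delta>>0. \<forall>y s. y \<in> X \<longrightarrow> norm (y - a) = 1 \<longrightarrow> f y \<le> ereal s \<longrightarrow> m + \<delta> \<le> s"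
  proof -
    have gt: "m < s" if "y \<in> X" "norm (y - a) = 1" "f y \<le> ereal s" for y s
    proof -
      have "y \<noteq> a" using that(2) by auto
      then have "ereal m < f y" using min[of y] that(1) a(2) by simp
      then show ?thesis using that(3) by (metis less_ereal.simps(1) less_le_trans)
    qed
    \<comment> \<open>Cutting the heights at \<open>m + 1\<close> makes this part of the epigraph
      compact. If it is empty, the gap 1 works; otherwise its lowest height gives the gap.\<close>
    define C where "C = {(x, s). f x \<le> ereal s} \<inter> (X \<inter> sphere a 1) \<times> {m..m + 1}"
    have "compact C"
      unfolding C_def using closed_epigraph[OF lsc] X
      by (intro closed_Int_compact compact_Times) auto
    have C: "(y, s) \<in> C" if "y \<in> X" "norm (y - a) = 1" "f y \<le> ereal s" "s \<le> m + 1" for y s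
      using that gt[OF that(1-3)] by (auto simp: C_def dist_norm norm_minus_commute)
    show ?thesis
    proof (cases "C = {}")
      case True
      have "m + 1 \<le> s" if "y \<in> X" "norm (y - a) = 1" "f y \<le> ereal s" for y s
        using C[OF that] True by fastforce
      then show ?thesis by (intro exI[of _ 1]) auto
    next
      case False
      from continuous_attains_inf[OF \<open>compact C\<close> this continuous_on_snd[OF continuous_on_id]]
      obtain z where z: "z \<in> C" "\<And>w. w \<in> C \<Longrightarrow> snd z \<le> snd w" by auto
      obtain y0 s0 where y0: "z = (y0, s0)" by (cases z)
      have "m < s0" using z(1) gt[of y0 s0] by (auto simp: C_def y0 dist_norm norm_minus_commute)
      moreover have "s0 \<le> s" if "y \<in> X" "norm (y - a) = 1" "f y \<le> ereal s" for y s
      proof (cases "s \<le> m + 1")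
        case True
        then show ?thesis using z(2)[OF C[OF that]] y0 by simp
      next
        case False
        then show ?thesis using z(1) y0 by (auto simp: C_def)
      qed
      ultimately show ?thesis by (intro exI[of _ "s0 - m"]) auto
    qed
  qed
  then obtain \<delta> where \<delta>: "0 < \<delta>"
    "\<And>y s. y \<in> X \<Longrightarrow> norm (y - a) = 1 \<Longrightarrow> f y \<le> ereal s \<Longrightarrow> m + \<delta> \<le> s" by blast
  have "norm (x - a) \<le> max 1 ((\<alpha> - m) / \<delta>)" if x: "x \<in> X" "f x \<le> ereal \<alpha>" for x
  proof (cases "norm (x - a) \<le> 1")
    case False
    \<comment> \<open>This factor moves \<open>x\<close> along the segment from \<open>a\<close>
      onto the unit sphere around \<open>a\<close>.\<close>
    define u where "u = 1 / norm (x - a)"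
    have "x \<noteq> a" using False by auto
    then have u: "0 < u" "u < 1" using False by (simp_all add: u_def)
    let ?y = "(1 - u) *\<^sub>R a + u *\<^sub>R x"
    have "?y - a = u *\<^sub>R (x - a)" by (simp add: algebra_simps)
    then have "norm (?y - a) = \<bar>u\<bar> * norm (x - a)" by simp
    then have "norm (?y - a) = 1" using u by (simp add: u_def)
    moreover have "?y \<in> X" using X(2) a(1) x(1) u by (auto simp: convex_alt)
    moreover have "f ?y \<le> ereal ((1 - u) * m + u * \<alpha>)"
      using econvex_on_epi[OF conv _ x(2) u] a(2) by simp
    ultimately have "m + \<delta> \<le> (1 - u) * m + u * \<alpha>" using \<delta>(2) by blast
    then have "\<delta> \<le> u * (\<alpha> - m)" by (simp add: algebra_simps)
    then have "norm (x - a) * \<delta> \<le> norm (x - a) * (u * (\<alpha> - m))" by (intro mult_left_mono) auto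
    also have "\<dots> = (norm (x - a) * u) * (\<alpha> - m)" by simp
    also have "norm (x - a) * u = 1" using u by (auto simp: u_def)
    finally have "norm (x - a) \<le> (\<alpha> - m) / \<delta>" using \<delta>(1) by (simp add: field_simps)
    then show ?thesis by simp
  qed auto
  then have "{x \<in> X. f x \<le> ereal \<alpha>} \<subseteq> cball a (max 1 ((\<alpha> - m) / \<delta>))"
    by (auto simp: dist_norm norm_minus_commute)
  then show ?thesis using bounded_cball bounded_subset by blast
qed

section \<open>Properties derived from the orthogonal decomposition\<close>

locale decomposed =
  fixes \<Phi> :: "real^'n \<Rightarrow> ereal" and X1 X2 X3 :: "(real^'n) set"
    and L :: "real^'n^'m" and N :: "real^'m \<Rightarrow> real"
  assumes proper: "proper_on UNIV \<Phi>" and conv: "econvex_on UNIV \<Phi>" and lsc: "lsc_on UNIV \<Phi>"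
    and setting: "structural_setting \<Phi> X1 X2 X3"
    and X2_kernel: "X2 \<inter> {x. L *v x = 0} = {0}"
    and norm: "is_norm N"
begin

lemma not_MInf: "\<Phi> x \<noteq> -\<infinity>"
  using proper by (auto simp: proper_on_def)

lemma subspace_X1: "subspace X1" and subspace_X2: "subspace X2"
  and \<Phi>_sum: "\<lbrakk>x1 \<in> X1; x2 \<in> X2; x3 \<in> X3\<rbrakk>
    \<Longrightarrow> \<Phi> (x1 + x2 + x3) = (if x3 = 0 then \<Phi> x1 else \<infinity>)"
  using setting by (auto simp: structural_setting_def orthogonal_decomposition_def)

lemma decomposition:
  obtains x1 x2 x3 where "x1 \<in> X1" "x2 \<in> X2" "x3 \<in> X3" "x = x1 + x2 + x3"
proof -
  have "\<exists>!(x1, x2, x3). x1 \<in> X1 \<and> x2 \<in> X2 \<and> x3 \<in> X3 \<and> x = x1 + x2 + x3"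
    using setting by (auto simp: structural_setting_def orthogonal_decomposition_def)
  then show thesis using that by (auto dest!: ex1_implies_ex)
qed

lemma finite_decomposition:
  assumes "\<Phi> x \<noteq> \<infinity>"
  obtains x1 x2 where "x1 \<in> X1" "x2 \<in> X2" "x = x1 + x2" "\<Phi> x = \<Phi> x1"
proof -
  obtain x1 x2 x3 where x: "x1 \<in> X1" "x2 \<in> X2" "x3 \<in> X3" "x = x1 + x2 + x3"
    by (rule decomposition)
  then show thesis using that \<Phi>_sum[OF x(1-3)] assms by (cases "x3 = 0") auto
qed

lemma translate: assumes "k \<in> X2" shows "\<Phi> (x + k) = \<Phi> x"
proof -
  obtain x1 x2 x3 where x: "x1 \<in> X1" "x2 \<in> X2" "x3 \<in> X3" "x = x1 + x2 + x3"
    by (rule decomposition)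
  have "x + k = x1 + (x2 + k) + x3" using x(4) by simp
  also have "\<Phi> \<dots> = \<Phi> x"
    using \<Phi>_sum[OF x(1-3)] \<Phi>_sum[OF x(1) subspace_add[OF subspace_X2 x(2) assms] x(3)]
    by (simp add: x(4))
  finally show ?thesis .
qed

lemma strict_X1:
  assumes "x \<in> X1" "y \<in> X1" "x \<noteq> y" "\<Phi> x = ereal a" "\<Phi> y = ereal b"
  shows "\<Phi> ((1/2) *\<^sub>R x + (1/2) *\<^sub>R y) < ereal ((a + b) / 2)"
proof -
  have "strictly_econvex_on X1 \<Phi>" using setting by (simp add: structural_setting_def)
  then have "\<Phi> ((1 - 1/2) *\<^sub>R x + (1/2) *\<^sub>R y) < ereal (1 - 1/2) * \<Phi> x + ereal (1/2) * \<Phi> y"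
    using assms unfolding strictly_econvex_on_def edom_on_def
    by (metis (no_types, lifting) PInfty_neq_ereal(1) ereal_infty_less(1) greaterThanLessThan_iff half_gt_zero_iff
        less_numeral_extra(1) mem_Collect_eq field_sum_of_halves less_add_same_cancel1)
  then show ?thesis using assms by (simp add: add_divide_distrib)
qed

text \<open>Every finite value of \<open>\<Phi>\<close> is already taken on \<open>X1\<close>, so
  the minimizer there is global; strict convexity makes it the only one in
  \<open>X1\<close>.\<close>

lemma minimizer:
  obtains a m where "a \<in> X1" "\<Phi> a = ereal m" "\<And>x. \<Phi> a \<le> \<Phi> x"
    "\<And>y. y \<in> X1 \<Longrightarrow> y \<noteq> a \<Longrightarrow> \<Phi> a < \<Phi> y"
proof -
  obtain a where a: "a \<in> X1" "\<And>y. y \<in> X1 \<Longrightarrow> \<Phi> a \<le> \<Phi> y"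
    using setting by (auto simp: structural_setting_def)
  have le: "\<Phi> a \<le> \<Phi> x" for x
  proof (cases "\<Phi> x = \<infinity>")
    case False
    then obtain x1 x2 where "x1 \<in> X1" "\<Phi> x = \<Phi> x1" by (rule finite_decomposition)
    then show ?thesis using a(2) by simp
  qed simp
  obtain z where "\<Phi> z < \<infinity>" using proper by (auto simp: proper_on_def edom_on_def)
  then have "\<Phi> a \<noteq> \<infinity>" using le[of z] by auto
  then obtain m where m: "\<Phi> a = ereal m" using not_MInf[of a] by (cases "\<Phi> a") auto
  have "\<Phi> a < \<Phi> y" if y: "y \<in> X1" "y \<noteq> a" for y
  proof (rule ccontr)
    assume "\<not> \<Phi> a < \<Phi> y"
    then have "\<Phi> y = ereal m" using le[of y] m by simp
    then show False using strict_X1[OF a(1) y(1) _ m] le[of "(1/2) *\<^sub>R a + (1/2) *\<^sub>R y"] y(2) m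
      by fastforce
  qed
  then show thesis using that a(1) m le by blast
qed

lemma strict:
  assumes "\<Phi> x = ereal a" "\<Phi> y = ereal b" "x - y \<notin> X2"
  shows "\<Phi> ((1/2) *\<^sub>R x + (1/2) *\<^sub>R y) < ereal ((a + b) / 2)"
proof -
  obtain x1 x2 where x: "x1 \<in> X1" "x2 \<in> X2" "x = x1 + x2" "\<Phi> x = \<Phi> x1"
    using finite_decomposition[of x] assms by auto
  obtain y1 y2 where y: "y1 \<in> X1" "y2 \<in> X2" "y = y1 + y2" "\<Phi> y = \<Phi> y1"
    using finite_decomposition[of y] assms by auto
  have "x1 \<noteq> y1" using assms(3) x y subspace_diff[OF subspace_X2 x(2) y(2)] by auto
  then have "\<Phi> ((1/2) *\<^sub>R x1 + (1/2) *\<^sub>R y1) < ereal ((a + b) / 2)"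
    using strict_X1 x y assms by metis
  moreover have "(1/2) *\<^sub>R x + (1/2) *\<^sub>R y
      = (1/2) *\<^sub>R x1 + (1/2) *\<^sub>R y1 + ((1/2) *\<^sub>R x2 + (1/2) *\<^sub>R y2)"
    using x y by (simp add: algebra_simps)
  moreover have "(1/2) *\<^sub>R x2 + (1/2) *\<^sub>R y2 \<in> X2"
    using x y subspace_X2 by (intro subspace_add subspace_scale)
  ultimately show ?thesis using translate by metis
qed

text \<open>The points with \<open>N (L *v x) < \<tau>\<close> form an open neighbourhood of 0, and
  0 is in the closure of the effective domain.\<close>

lemma slater:
  assumes "0 < \<tau>"
  shows "\<exists>x s. \<Phi> x = ereal s \<and> N (L *v x) < \<tau>"
proof -
  have "open {x. N (L *v x) < \<tau>}"
    by (intro open_Collect_less continuous_on_const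
        continuous_on_compose2[OF continuous_on_is_norm[OF norm, of UNIV]
          matrix_vector_mult_linear_continuous_on]) auto
  moreover have "0 \<in> {x. N (L *v x) < \<tau>}" using assms by (simp add: is_norm_zero[OF norm])
  moreover have "0 \<in> closure (edom_on X1 \<Phi>)" using setting by (simp add: structural_setting_def)
  ultimately have "{x. N (L *v x) < \<tau>} \<inter> edom_on X1 \<Phi> \<noteq> {}"
    using open_Int_closure_eq_empty by blast
  then obtain x where x: "N (L *v x) < \<tau>" "\<Phi> x < \<infinity>" by (auto simp: edom_on_def)
  then show ?thesis using not_MInf[of x] by (cases "\<Phi> x") auto
qed

text \<open>The \<open>X1\<close> component is bounded by the sublevel bound for a unique minimizer.
  On \<open>X2\<close> the map \<open>L\<close> is injective and hence bounded below, so a bound on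
  \<open>L *v x\<close> together with one on \<open>L *v x1\<close> bounds the \<open>X2\<close>
  component. Closedness comes from lower semicontinuity.\<close>

lemma compact_sublevel: "compact {(x, s). \<Phi> x \<le> ereal s \<and> s \<le> \<alpha> \<and> N (L *v x) \<le> \<beta>}"
proof -
  let ?C = "{(x, s). \<Phi> x \<le> ereal s \<and> s \<le> \<alpha> \<and> N (L *v x) \<le> \<beta>}"
  obtain a m where a: "a \<in> X1" "\<Phi> a = ereal m" "\<And>x. \<Phi> a \<le> \<Phi> x"
    "\<And>y. y \<in> X1 \<Longrightarrow> y \<noteq> a \<Longrightarrow> \<Phi> a < \<Phi> y" using minimizer by metis
  have "bounded {x \<in> X1. \<Phi> x \<le> ereal \<alpha>}"
    using bounded_sublevel_unique_minimizer[OF lsc conv closed_subspace[OF subspace_X1]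
        subspace_imp_convex[OF subspace_X1] a(1,2,4)] .
  then obtain B where B: "\<And>x. x \<in> X1 \<Longrightarrow> \<Phi> x \<le> ereal \<alpha> \<Longrightarrow> norm x \<le> B"
    by (auto simp: bounded_iff)
  obtain e where e: "0 < e" "\<And>y. e * norm y \<le> N y" using is_norm_ge_norm[OF norm] by blast
  obtain e' where e': "0 < e'" "\<And>x. x \<in> X2 \<Longrightarrow> e' * norm x \<le> norm (L *v x)"
    using injective_imp_isometric[OF closed_subspace[OF subspace_X2] subspace_X2
        matrix_vector_mul_bounded_linear[of L]] X2_kernel by auto
  obtain M where M: "0 < M" "\<And>x. norm (L *v x) \<le> norm x * M"
    using bounded_linear.pos_bounded[OF matrix_vector_mul_bounded_linear[of L]] by auto
  \<comment> \<open>\<open>B\<close> bounds the \<open>X1\<close> component,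
    \<open>\<beta> / e + B * M\<close> the image of the \<open>X2\<close> component, and division by
    \<open>e'\<close> undoes \<open>L\<close> on \<open>X2\<close>.\<close>
  define r where "r = B + (\<beta> / e + B * M) / e'"
  have "norm x \<le> r \<and> s \<in> {m..\<alpha>}" if C: "\<Phi> x \<le> ereal s" "s \<le> \<alpha>" "N (L *v x) \<le> \<beta>" for x s
  proof
    have \<alpha>: "\<Phi> x \<le> ereal \<alpha>" using C(1,2) by (metis ereal_less_eq(3) order_trans)
    then have "\<Phi> x \<noteq> \<infinity>" by auto
    then obtain x1 x2 where x: "x1 \<in> X1" "x2 \<in> X2" "x = x1 + x2" "\<Phi> x = \<Phi> x1"
      by (rule finite_decomposition)
    have x1: "norm x1 \<le> B" using B x \<alpha> by simp
    have "e * norm (L *v x) \<le> \<beta>" using e(2)[of "L *v x"] C(3) by simp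
    then have Lx: "norm (L *v x) \<le> \<beta> / e" using e(1) by (simp add: field_simps)
    have "L *v x2 = L *v x - L *v x1" using x by (simp add: matrix_vector_right_distrib)
    then have "norm (L *v x2) \<le> norm (L *v x) + norm (L *v x1)"
      by (metis norm_triangle_ineq4)
    also have "\<dots> \<le> \<beta> / e + B * M"
      using Lx M(2)[of x1] mult_right_mono[OF x1, of M] M(1) by linarith
    finally have "e' * norm x2 \<le> \<beta> / e + B * M" using e'(2)[OF x(2)] by simp
    then have "norm x2 \<le> (\<beta> / e + B * M) / e'"
      using e'(1) by (simp add: pos_le_divide_eq mult.commute)
    then show "norm x \<le> r" using x1 norm_triangle_ineq[of x1 x2] x(3) by (simp add: r_def)
    have "ereal m \<le> ereal s" using a(2,3) C(1) by (metis order_trans)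
    then show "s \<in> {m..\<alpha>}" using C(2) by simp
  qed
  then have "?C \<subseteq> cball 0 r \<times> {m..\<alpha>}" by auto
  then have "bounded ?C" using bounded_Times[OF bounded_cball bounded_closed_interval] bounded_subset by blast
  moreover have "?C = {(x, s). \<Phi> x \<le> ereal s} \<inter> {z. snd z \<le> \<alpha>} \<inter> {z. N (L *v fst z) \<le> \<beta>}"
    by auto
  moreover have "closed {z :: (real^'n) \<times> real. snd z \<le> \<alpha>}"
    by (intro closed_Collect_le continuous_on_snd continuous_on_id continuous_on_const)
  moreover have "continuous_on UNIV (\<lambda>z :: (real^'n) \<times> real. L *v fst z)"
    by (rule continuous_on_compose2[OF matrix_vector_mult_linear_continuous_on[of UNIV]
        continuous_on_fst[OF continuous_on_id]]) auto
  then have "continuous_on UNIV (\<lambda>z :: (real^'n) \<times> real. N (L *v fst z))"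
    by (rule continuous_on_compose2[OF continuous_on_is_norm[OF norm, of UNIV]]) auto
  then have "closed {z :: (real^'n) \<times> real. N (L *v fst z) \<le> \<beta>}"
    by (intro closed_Collect_le continuous_on_const)
  ultimately show ?thesis using closed_epigraph[OF lsc] by (simp add: compact_eq_bounded_closed closed_Int)
qed

text \<open>
  \<open>x\<^sub>1\<close> is an interior point of the effective domain of \<open>\<Phi>\<close> on \<open>X1\<close>, so the subgradient inequality
  along the line \<open>x\<^sub>1 + t x\<^sub>1\<close> is an equality to first order.
\<close>

lemma smooth:
  assumes "fenchel_pair \<Phi> L x p" "fenchel_pair \<Phi> L x p'"
  shows "p \<bullet> (L *v x) = p' \<bullet> (L *v x)"
proof -
  obtain a where a: "\<Phi> x = ereal a" using assms by (auto simp: fenchel_pair_def)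
  obtain x1 x2 where x: "x1 \<in> X1" "x2 \<in> X2" "x = x1 + x2" "\<Phi> x = \<Phi> x1"
    using finite_decomposition[of x] a by auto
  let ?dom = "edom_on X1 \<Phi>"
  have op: "openin (top_of_set X1) ?dom" using setting by (simp add: structural_setting_def)
  have x1: "x1 \<in> ?dom" using x a by (simp add: edom_on_def)
  have "essentially_smooth_on X1 \<Phi>" using setting by (simp add: structural_setting_def)
  then have "\<forall>x\<in>?dom. \<exists>g. has_gradient_on X1 \<Phi> x g"
    unfolding essentially_smooth_on_def Let_def interior_of_openin[OF op] by (elim conjE)
  then obtain g where "has_gradient_on X1 \<Phi> x1 g" using x1 by blast
  then have der: "((\<lambda>y. real_of_ereal (\<Phi> y)) has_derivative (\<lambda>h. g \<bullet> h)) (at x1 within X1)"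
    by (simp add: has_gradient_on_def)
  define l where "l t = x1 + t *\<^sub>R x1" for t :: real
  have lX: "l t \<in> X1" for t
    unfolding l_def using x subspace_X1 by (intro subspace_add subspace_scale)
  have "(l has_derivative (\<lambda>t. t *\<^sub>R x1)) (at 0)"
    unfolding l_def by (auto intro!: derivative_eq_intros)
  moreover have "((\<lambda>y. real_of_ereal (\<Phi> y)) has_derivative (\<lambda>h. g \<bullet> h)) (at (l 0) within range l)"
    using has_derivative_subset[OF der, of "range l"] lX by (auto simp: l_def)
  ultimately have "((\<lambda>t. real_of_ereal (\<Phi> (l t))) has_derivative (\<lambda>t. g \<bullet> (t *\<^sub>R x1))) (at 0)"
    by (rule has_derivative_in_compose)
  then have deriv: "((\<lambda>t. real_of_ereal (\<Phi> (l t))) has_real_derivative (g \<bullet> x1)) (at 0)"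
    by (simp add: has_field_derivative_def mult.commute[of _ "g \<bullet> x1"])
  obtain U where U: "open U" "?dom = X1 \<inter> U" using op by (auto simp: openin_open)
  have "continuous_on UNIV l" unfolding l_def by (intro continuous_intros)
  then have "open (l -` U)" using U(1) by (simp add: open_vimage)
  moreover have "0 \<in> l -` U" using x1 U by (auto simp: l_def)
  \<comment> \<open>Within this radius the line stays in the effective domain, so
    \<open>real_of_ereal\<close> hides no infinite value.\<close>
  ultimately obtain \<delta> where \<delta>: "0 < \<delta>" "ball 0 \<delta> \<subseteq> l -` U" by (meson open_contains_ball)
  have fin: "\<Phi> (l t) = ereal (real_of_ereal (\<Phi> (l t)))" if "\<bar>t\<bar> < \<delta>" for t
  proof -
    have "l t \<in> ?dom" using U \<delta> lX that by (auto simp: dist_norm)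
    then show ?thesis using not_MInf[of "l t"] by (cases "\<Phi> (l t)") (auto simp: edom_on_def)
  qed
  \<comment> \<open>The pairing splits into an \<open>X1\<close> part, which the gradient
    determines, and an \<open>X2\<close> part, which vanishes because \<open>\<Phi>\<close> is
    constant along \<open>x2\<close>; neither depends on \<open>q\<close>.\<close>
  have "q \<bullet> (L *v x1) = - (g \<bullet> x1) \<and> q \<bullet> (L *v x2) = 0" if q: "fenchel_pair \<Phi> L x q" for q
  proof
    have sub: "ereal (a + q \<bullet> (L *v x) - q \<bullet> (L *v y)) \<le> \<Phi> y" for y
      using q a by (auto simp: fenchel_pair_def)
    have "0 \<le> t * (q \<bullet> (L *v x2))" for t
      using sub[of "x + t *\<^sub>R x2"] translate[OF subspace_scale[OF subspace_X2 x(2)], of x t] a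
      by (simp add: matrix_vector_right_distrib matrix_vector_mult_scaleR inner_add_right)
    from this[of 1] this[of "-1"] show "q \<bullet> (L *v x2) = 0" by simp
    \<comment> \<open>By the subgradient inequality this function has a local minimum at 0, so its
      derivative there is zero.\<close>
    let ?u = "\<lambda>t. real_of_ereal (\<Phi> (l t)) + t * (q \<bullet> (L *v x1))"
    have "(?u has_real_derivative (g \<bullet> x1 + q \<bullet> (L *v x1))) (at 0)"
      by (rule derivative_eq_intros deriv refl | simp)+
    moreover have "?u 0 \<le> ?u t" if "\<bar>0 - t\<bar> < \<delta>" for t
    proof -
      have "\<Phi> (l t + x2) = \<Phi> (l t)" using translate[OF x(2)] .
      moreover have "l t + x2 = x + t *\<^sub>R x1" using x by (simp add: l_def)
      ultimately have "ereal (a - t * (q \<bullet> (L *v x1))) \<le> \<Phi> (l t)"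
        using sub[of "l t + x2"]
        by (simp add: matrix_vector_right_distrib matrix_vector_mult_scaleR inner_add_right)
      then have "a - t * (q \<bullet> (L *v x1)) \<le> real_of_ereal (\<Phi> (l t))"
        using fin[of t] that by (metis abs_minus_commute diff_zero ereal_less_eq(3))
      moreover have "\<Phi> (l 0) = ereal a" using x a by (simp add: l_def)
      ultimately show ?thesis by simp
    qed
    ultimately have "g \<bullet> x1 + q \<bullet> (L *v x1) = 0" using DERIV_local_min \<delta>(1) by blast
    then show "q \<bullet> (L *v x1) = - (g \<bullet> x1)" by simp
  qed
  from this[OF assms(1)] this[OF assms(2)] show ?thesis
    using x(3) by (simp add: matrix_vector_right_distrib inner_add_right)
qed

sublocale homogeneous_penalization \<Phi> L N X2
proof
  show "\<exists>a. \<forall>y. \<Phi> a \<le> \<Phi> y" using minimizer by metis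
qed (use norm not_MInf convex_epigraph[OF conv] compact_sublevel slater subspace_X2 translate
    strict smooth in blast)+

end

theorem theorem4p4p6:
  fixes \<Phi> :: "real^'n \<Rightarrow> ereal"
    and X1 X2 X3 :: "(real^'n) set"
    and L :: "real^'n^'m"
    and N :: "real^'m \<Rightarrow> real"
    and c d :: ereal
  assumes "proper_on UNIV \<Phi>" and "econvex_on UNIV \<Phi>" and "lsc_on UNIV \<Phi>"
    and "structural_setting \<Phi> X1 X2 X3"
    and "X2 \<inter> {x. L *v x = 0} = {0}"
    and "X3 \<inter> range (\<lambda>p. transpose L *v p) = {0}"
    and "argmin \<Phi> \<inter> {x. L *v x = 0} = {}"
    and "is_norm N"
    and "c = (INF x\<in>argmin \<Phi>. ereal (N (L *v x)))"
    and "d = (INF p\<in>argmin (\<lambda>p. conjugate \<Phi> (- (transpose L *v p))). ereal (dual_norm N p))"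
  shows "(\<forall>\<tau>\<in>open_from_0 c. \<forall>\<mu>\<in>open_from_0 d.
            has_finite_minimum (P1 \<Phi> L N \<tau>) \<and> has_finite_minimum (P2 \<Phi> L N \<mu>) \<and>
            has_finite_minimum (D1 \<Phi> L N \<tau>) \<and> has_finite_minimum (D2 \<Phi> L N \<mu>)) \<and>
         (\<exists>g. bij_betw g (open_from_0 c) (open_from_0 d) \<and>
            (\<forall>\<tau>\<in>open_from_0 c. \<forall>\<mu>\<in>open_from_0 d. (\<tau>, \<mu>) \<in> graph_on (open_from_0 c) g \<longrightarrow>
               SOL (P1 \<Phi> L N \<tau>) = SOL (P2 \<Phi> L N \<mu>) \<and>
               SOL (D1 \<Phi> L N \<tau>) = SOL (D2 \<Phi> L N \<mu>)) \<and>
            (\<forall>\<tau> \<mu>. (\<tau> \<in> open_from_0 c \<and> \<mu> \<in> {0..} \<or> \<mu> \<in> open_from_0 d \<and> \<tau> \<in> {0..}) \<and>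
               (\<tau>, \<mu>) \<notin> graph_on (open_from_0 c) g \<longrightarrow>
               SOL (P1 \<Phi> L N \<tau>) \<inter> SOL (P2 \<Phi> L N \<mu>) = {} \<and>
               SOL (D1 \<Phi> L N \<tau>) \<inter> SOL (D2 \<Phi> L N \<mu>) = {}) \<and>
            (\<forall>\<tau> \<mu>. (\<tau>, \<mu>) \<in> graph_on (open_from_0 c) g \<longrightarrow>
               (\<forall>x\<in>SOL (P1 \<Phi> L N \<tau>) \<union> SOL (P2 \<Phi> L N \<mu>).
                \<forall>p\<in>SOL (D1 \<Phi> L N \<tau>) \<union> SOL (D2 \<Phi> L N \<mu>).
                  \<tau> = N (L *v x) \<and> \<mu> = dual_norm N p)))"
proof -
  interpret decomposed \<Phi> X1 X2 X3 L N
    using assms(1-5,8) by unfold_locales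
  have bounds: "c = primal_bound" "d = dual_bound"
    by (simp_all only: assms(9,10) primal_bound_def dual_bound_def \<psi>_def)
  obtain g where g: "bij_betw g (open_from_0 c) (open_from_0 d)"
    and graph: "\<And>\<tau> \<mu>. (\<tau>, \<mu>) \<in> graph_on (open_from_0 c) g \<longleftrightarrow> linked \<tau> \<mu>"
    using ex_bij_linked unfolding bounds by blast
  have disjoint: "SOL (P1 \<Phi> L N \<tau>) \<inter> SOL (P2 \<Phi> L N \<mu>) = {} \<and> SOL (D1 \<Phi> L N \<tau>) \<inter> SOL (D2 \<Phi> L N \<mu>) = {}"
    if range: "\<tau> \<in> open_from_0 c \<and> \<mu> \<in> {0..} \<or> \<mu> \<in> open_from_0 d \<and> \<tau> \<in> {0..}"
      and unlinked: "\<not> linked \<tau> \<mu>" for \<tau> \<mu>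
  proof -
    \<comment> \<open>Only one parameter is known to lie in its open interval; the other may be 0 or
      beyond its bound.\<close>
    have *: "0 \<le> \<tau>" "0 \<le> \<mu>"
      "0 < \<tau> \<and> ereal \<tau> < primal_bound \<or> 0 < \<mu> \<and> ereal \<mu> < dual_bound"
      using range by (auto simp: open_from_0_def bounds)
    show ?thesis
      using linked_of_primal[OF _ _ *(2,3)] linked_of_dual[OF _ _ *] unlinked by blast
  qed
  show ?thesis
  proof (intro conjI exI[of _ g])
    show "\<forall>\<tau>\<in>open_from_0 c. \<forall>\<mu>\<in>open_from_0 d.
        has_finite_minimum (P1 \<Phi> L N \<tau>) \<and> has_finite_minimum (P2 \<Phi> L N \<mu>) \<and>
        has_finite_minimum (D1 \<Phi> L N \<tau>) \<and> has_finite_minimum (D2 \<Phi> L N \<mu>)"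
      using finite_minima by (simp add: bounds)
    show "bij_betw g (open_from_0 c) (open_from_0 d)" by (rule g)
    show "\<forall>\<tau>\<in>open_from_0 c. \<forall>\<mu>\<in>open_from_0 d. (\<tau>, \<mu>) \<in> graph_on (open_from_0 c) g \<longrightarrow>
        SOL (P1 \<Phi> L N \<tau>) = SOL (P2 \<Phi> L N \<mu>) \<and> SOL (D1 \<Phi> L N \<tau>) = SOL (D2 \<Phi> L N \<mu>)"
      using linked_SOL_eq by (simp add: graph)
    show "\<forall>\<tau> \<mu>. (\<tau> \<in> open_from_0 c \<and> \<mu> \<in> {0..} \<or> \<mu> \<in> open_from_0 d \<and> \<tau> \<in> {0..}) \<and>
        (\<tau>, \<mu>) \<notin> graph_on (open_from_0 c) g \<longrightarrow>
        SOL (P1 \<Phi> L N \<tau>) \<inter> SOL (P2 \<Phi> L N \<mu>) = {} \<and> SOL (D1 \<Phi> L N \<tau>) \<inter> SOL (D2 \<Phi> L N \<mu>) = {}"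
      unfolding graph using disjoint by blast
    show "\<forall>\<tau> \<mu>. (\<tau>, \<mu>) \<in> graph_on (open_from_0 c) g \<longrightarrow>
        (\<forall>x\<in>SOL (P1 \<Phi> L N \<tau>) \<union> SOL (P2 \<Phi> L N \<mu>).
         \<forall>p\<in>SOL (D1 \<Phi> L N \<tau>) \<union> SOL (D2 \<Phi> L N \<mu>).
           \<tau> = N (L *v x) \<and> \<mu> = dual_norm N p)"
      unfolding graph using linked_solutions by blast
  qed
qed

end
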